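(* For any integer $m\geq 4$, the set of points $Z_m\subset\mathbb{P}^2=\mathbb{P}^2_{\mathbb{C}}$ dual to the full monomial arrangement $$\mathcal{M}_m: xyz(x^{m-2}-y^{m-2})(y^{m-2}-z^{m-2})(z^{m-2}-x^{m-2})=0$$ admits unexpected curves of minimal degree $m$ (that is, $m$ is the smallest degree in which $Z_m$ admits unexpected curves), and all of these unexpected curves of degree $m$ are irreducible.
   Context: Work over $\mathbb{C}$. Unexpected curves: a finite set $Z\subset\mathbb{P}^2$ admits unexpected curves of degree $j\geq 2$ if, for a generic point $q\in\mathbb{P}^2$ (i.e. for $q$ in a nonempty Zariski open subset), $$h^0(\mathbb{P}^2,\mathcal{O}_{\mathbb{P}^2}(j)\otimes\mathcal{I}(Z+(j-1)q))>\max\left(0,\ h^0(\mathbb{P}^2,\mathcal{O}_{\mathbb{P}^2}(j)\otimes\mathcal{I}(Z))-\binom{j}{2}\right),$$ where $\mathcal{I}(Z)$ is the ideal sheaf of functions vanishing on $Z$ and $\mathcal{I}(Z+(j-1)q)$ is the ideal sheaf of functions vanishing on $Z$ and vanishing to order $j-1$ at $q$. An unexpected curve of degree $j$ (for generic $q$) is then a curve $C_q$ of degree $j$ passing through all points of $Z$ and having multiplicity at least $j-1$ at $q$; irreducibility is asserted for generic $q$. Duality: a point $(a:b:c)\in\mathbb{P}^2$ is dual to the line $ax+by+cz=0$; the set dual to a line arrangement is the set of points dual to its lines. *)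

theory Defs
  imports "HOL-Analysis.Cartesian_Space" "HOL-Computational_Algebra.Polynomial_Factorial"
begin

section \<open>Polynomials in three variables over the complex numbers\<close>

text \<open>
  The ring \<open>C[x,y,z]\<close> is taken as \<open>C[x][y][z]\<close>: the outermost variable is \<open>z\<close>, the innermost is \<open>x\<close>.
\<close>

type_synonym poly3 = "complex poly poly poly"

definition X :: poly3 where "X = [:[:[:0, 1:]:]:]"
definition Y :: poly3 where "Y = [:[:0, 1:]:]"
definition Z :: poly3 where "Z = [:0, 1:]"

definition eval3 :: "poly3 \<Rightarrow> complex ^ 3 \<Rightarrow> complex" where
  "eval3 F v = poly (poly (poly F [:[:v $ 3:]:]) [:v $ 2:]) (v $ 1)"

definition scale3 :: "complex \<Rightarrow> poly3 \<Rightarrow> poly3" where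
  "scale3 c F = smult [:[:c:]:] F"

global_interpretation poly3: vector_space scale3
  by unfold_locales
    (simp_all add: scale3_def smult_add_right flip: smult_add_left one_pCons)

text \<open>The zero polynomial is homogeneous of every degree, so the forms of degree \<open>d\<close> are a vector space.\<close>

definition homogeneous :: "nat \<Rightarrow> poly3 \<Rightarrow> bool" where
  "homogeneous d F \<longleftrightarrow>
     (\<forall>a b c. coeff (coeff (coeff F c) b) a \<noteq> 0 \<longrightarrow> a + b + c = d)"

definition partial :: "3 \<Rightarrow> poly3 \<Rightarrow> poly3" where
  "partial i F =
     (if i = 1 then map_poly (map_poly pderiv) F
      else if i = 2 then map_poly pderiv F
      else pderiv F)"


section \<open>The complex projective plane\<close>

definition proportional :: "complex ^ 3 \<Rightarrow> complex ^ 3 \<Rightarrow> bool" where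
  "proportional v w \<longleftrightarrow> v \<noteq> 0 \<and> w \<noteq> 0 \<and> (\<exists>c. w = c *s v)"

lemma part_equivp_proportional: "part_equivp proportional"
proof (rule part_equivpI)
  have "proportional (axis 1 1) (axis 1 1)"
    unfolding proportional_def by (auto simp: axis_eq_0_iff intro: exI[of _ 1])
  then show "\<exists>v. proportional v v" ..
  show "symp proportional"
  proof (rule sympI)
    fix v w assume "proportional v w"
    then obtain c where c: "v \<noteq> 0" "w \<noteq> 0" "w = c *s v"
      unfolding proportional_def by blast
    then have "c \<noteq> 0" by auto
    with c have "v = inverse c *s w" by (simp add: vector_smult_assoc)
    with c show "proportional w v" unfolding proportional_def by blast
  qed
  show "transp proportional"
    by (rule transpI) (auto simp: proportional_def vector_smult_assoc)
qed

quotient_type proj_plane = "complex ^ 3" / partial: proportional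
  by (rule part_equivp_proportional)

definition homogeneous_coords :: "proj_plane \<Rightarrow> complex ^ 3 \<Rightarrow> bool" where
  "homogeneous_coords p v \<longleftrightarrow> v \<noteq> 0 \<and> abs_proj_plane v = p"

text \<open>
  \<open>vanishes_to_order k F p\<close>: the multiplicity of \<open>F\<close> at \<open>p\<close> is at least \<open>k\<close>, that is, all
  iterated partial derivatives of \<open>F\<close> of order less than \<open>k\<close> vanish at \<open>p\<close>. It is only used for
  homogeneous \<open>F\<close>, where it does not depend on the choice of homogeneous coordinates.
\<close>

definition vanishes_to_order :: "nat \<Rightarrow> poly3 \<Rightarrow> proj_plane \<Rightarrow> bool" where
  "vanishes_to_order k F p \<longleftrightarrow>
     (\<forall>v. homogeneous_coords p v \<longrightarrow>
        (\<forall>is. length is < k \<longrightarrow> eval3 (foldr partial is F) v = 0))"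

definition vanishes_at :: "poly3 \<Rightarrow> proj_plane \<Rightarrow> bool" where
  "vanishes_at F p \<longleftrightarrow> (\<forall>v. homogeneous_coords p v \<longrightarrow> eval3 F v = 0)"

definition zero_locus :: "poly3 set \<Rightarrow> proj_plane set" where
  "zero_locus S = {p. \<forall>F\<in>S. vanishes_at F p}"

definition zariski_closed :: "proj_plane set \<Rightarrow> bool" where
  "zariski_closed A \<longleftrightarrow>
     (\<exists>S. (\<forall>F\<in>S. \<exists>d. homogeneous d F) \<and> A = zero_locus S)"

definition zariski_open :: "proj_plane set \<Rightarrow> bool" where
  "zariski_open U \<longleftrightarrow> zariski_closed (- U)"

definition generically :: "(proj_plane \<Rightarrow> bool) \<Rightarrow> bool" where
  "generically P \<longleftrightarrow> (\<exists>U. zariski_open U \<and> U \<noteq> {} \<and> (\<forall>q\<in>U. P q))"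


section \<open>Unexpected curves\<close>

text \<open>
  The spaces of global sections of \<open>O(j)\<close> twisted by the ideal sheaves \<open>I(A)\<close> and \<open>I(A + k q)\<close>,
  as spaces of forms of degree \<open>j\<close>; the quantities \<open>h\<^sup>0\<close> are their dimensions.
\<close>

definition sections :: "nat \<Rightarrow> proj_plane set \<Rightarrow> poly3 set" where
  "sections j A = {F. homogeneous j F \<and> (\<forall>p\<in>A. vanishes_at F p)}"

definition sections_fat :: "nat \<Rightarrow> proj_plane set \<Rightarrow> nat \<Rightarrow> proj_plane \<Rightarrow> poly3 set" where
  "sections_fat j A k q = {F \<in> sections j A. vanishes_to_order k F q}"

definition admits_unexpected_curves :: "proj_plane set \<Rightarrow> nat \<Rightarrow> bool" where
  "admits_unexpected_curves A j \<longleftrightarrow> finite A \<and> j \<ge> 2 \<and>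
     generically (\<lambda>q.
       int (poly3.dim (sections_fat j A (j - 1) q))
         > max 0 (int (poly3.dim (sections j A)) - int (j choose 2)))"


section \<open>Duality and the full monomial arrangement\<close>

lift_definition incident :: "proj_plane \<Rightarrow> proj_plane \<Rightarrow> bool" is
  "\<lambda>u v. u $ 1 * v $ 1 + u $ 2 * v $ 2 + u $ 3 * v $ 3 = 0"
proof -
  fix u u' v v' assume "proportional u u'" "proportional v v'"
  then obtain c d where cd: "u' = c *s u" "v' = d *s v" "c \<noteq> 0" "d \<noteq> 0"
    unfolding proportional_def by auto
  have "u' $ 1 * v' $ 1 + u' $ 2 * v' $ 2 + u' $ 3 * v' $ 3
      = c * d * (u $ 1 * v $ 1 + u $ 2 * v $ 2 + u $ 3 * v $ 3)"
    unfolding cd by (simp add: algebra_simps)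
  with cd show "(u $ 1 * v $ 1 + u $ 2 * v $ 2 + u $ 3 * v $ 3 = 0)
      = (u' $ 1 * v' $ 1 + u' $ 2 * v' $ 2 + u' $ 3 * v' $ 3 = 0)"
    by simp
qed

text \<open>The line \<open>a x + b y + c z = 0\<close> dual to the point \<open>(a : b : c)\<close>.\<close>

definition dual_line :: "proj_plane \<Rightarrow> proj_plane set" where
  "dual_line p = {r. incident p r}"

definition is_line :: "proj_plane set \<Rightarrow> bool" where
  "is_line L \<longleftrightarrow> (\<exists>p. L = dual_line p)"

text \<open>The line arrangement with equation \<open>F = 0\<close>, for \<open>F\<close> a product of linear forms.\<close>

definition arrangement :: "poly3 \<Rightarrow> proj_plane set set" where
  "arrangement F = {L. is_line L \<and> L \<subseteq> zero_locus {F}}"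

definition dual_points :: "proj_plane set set \<Rightarrow> proj_plane set" where
  "dual_points \<A> = {p. dual_line p \<in> \<A>}"

definition full_monomial_poly :: "nat \<Rightarrow> poly3" where
  "full_monomial_poly m =
     X * Y * Z * (X ^ (m - 2) - Y ^ (m - 2)) * (Y ^ (m - 2) - Z ^ (m - 2))
       * (Z ^ (m - 2) - X ^ (m - 2))"

definition full_monomial_dual :: "nat \<Rightarrow> proj_plane set" where
  "full_monomial_dual m = dual_points (arrangement (full_monomial_poly m))"

end

theory Submission
  imports Defs "HOL-Computational_Algebra.Fundamental_Theorem_Algebra" "HOL-Analysis.Derivative"
begin

text \<open>
  Put \<open>n = m - 2\<close> and let \<open>q\<close> be a general point. The derivation \<open>(x\<^sup>n\<^sup>+\<^sup>1, y\<^sup>n\<^sup>+\<^sup>1, z\<^sup>n\<^sup>+\<^sup>1)\<close> is tangent to the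
  arrangement, which makes the form \<open>E(w) = \<Sum>\<^sub>i w\<^sub>i ((w \<times> q)\<^sub>i)\<^sup>n\<^sup>+\<^sup>1\<close> of degree \<open>m\<close> vanish on the dual points;
  it visibly has multiplicity \<open>m - 1\<close> at \<open>q\<close>.

  A form \<open>F\<close> of degree \<open>j\<close> with multiplicity at least \<open>j - 1\<close> at \<open>q\<close> satisfies \<open>D\<^sub>q\<^sup>2 F = 0\<close>, so
  \<open>F(w + s q) = F(w) + s G(w)\<close> with \<open>G = D\<^sub>q F\<close>. Each side of the coordinate triangle contains \<open>m\<close> of the dual
  points. For \<open>j < m\<close> the form \<open>F\<close> therefore vanishes on the sides, and being affine along lines
  through \<open>q\<close> it is zero. For \<open>j = m\<close> a suitable \<open>F - \<kappa> E\<close> vanishes on the side \<open>z = 0\<close>; then its \<open>G\<close>, of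
  degree \<open>m - 1\<close>, vanishes at the projections from \<open>q\<close> to that side of the dual points off it,
  which are at least \<open>m\<close> many, so \<open>F = \<kappa> E\<close>.

  In coordinates where \<open>q = (0 : 0 : 1)\<close> the form \<open>E\<close> is \<open>P(x, y) + z Q(x, y)\<close>, with \<open>P\<close> and \<open>Q\<close> coprime for
  general \<open>q\<close>, hence irreducible. Finally, the dual points impose enough conditions on forms of
  degree \<open>m\<close> to make the expected dimension nonpositive.
\<close>

section \<open>Polynomials in three variables as functions\<close>

lemma eval3_simps [simp]:
  "eval3 0 v = 0" "eval3 1 v = 1"
  "eval3 (F + G) v = eval3 F v + eval3 G v"
  "eval3 (F - G) v = eval3 F v - eval3 G v"
  "eval3 (- F) v = - eval3 F v"
  "eval3 (F * G) v = eval3 F v * eval3 G v"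
  "eval3 (F ^ k) v = eval3 F v ^ k"
  "eval3 (scale3 \<kappa> F) v = \<kappa> * eval3 F v"
  "eval3 X v = v $ 1" "eval3 Y v = v $ 2" "eval3 Z v = v $ 3"
  "eval3 [:[:[:\<kappa>:]:]:] v = \<kappa>"
  by (simp_all add: eval3_def scale3_def X_def Y_def Z_def)

lemma eval3_prod [simp]: "eval3 (prod f A) v = (\<Prod>i\<in>A. eval3 (f i) v)"
  by (induction A rule: infinite_finite_induct) simp_all

text \<open>A nonzero polynomial over a domain has finitely many roots, but the range of
  \<open>f\<close> is infinite. With \<open>f\<close> embedding the complex constants, this removes
  one variable at a time from a nested polynomial.\<close>

lemma poly_eq_0_if_zero_on_range:
  fixes p :: "'a::idom poly" and f :: "complex \<Rightarrow> 'a"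
  assumes "inj f" "\<And>x. poly p (f x) = 0"
  shows "p = 0"
proof (rule ccontr)
  assume "p \<noteq> 0"
  then have "finite {x. poly p x = 0}" by (rule poly_roots_finite)
  then have "finite (range f)" by (rule finite_subset[rotated]) (use assms in auto)
  then show False using finite_imageD[OF _ \<open>inj f\<close>] infinite_UNIV_char_0 by blast
qed

lemma eval3_eq_0:
  assumes "\<And>v. eval3 F v = 0"
  shows "F = 0"
proof -
  have "poly (poly (poly F [:[:z:]:]) [:y:]) x = 0" for x y z
    using assms[of "vector [x, y, z]"] by (simp add: eval3_def)
  then have "poly (poly F [:[:z:]:]) [:y:] = 0" for y z
    using poly_all_0_iff_0 by blast
  then have "poly F [:[:z:]:] = 0" for z
    by (intro poly_eq_0_if_zero_on_range[of "\<lambda>y. [:y:]"]) (auto simp: inj_def)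
  then show ?thesis
    by (intro poly_eq_0_if_zero_on_range[of "\<lambda>z. [:[:z:]:]"]) (auto simp: inj_def)
qed

lemma eval3_eqI:
  assumes "\<And>v. eval3 F v = eval3 G v"
  shows "F = G"
  using eval3_eq_0[of "F - G"] assms by simp

text \<open>Three nested \<open>pCons\<close> inductions, one per variable, write
  \<open>pCons a p\<close> as the coefficient plus the variable times \<open>p\<close>. A claim
  compatible with sums and products then has to be checked on generators only.\<close>

lemma poly3_induct:
  assumes const: "\<And>\<kappa>. P [:[:[:\<kappa>:]:]:]"
    and vars: "P X" "P Y" "P Z"
    and add: "\<And>F G. P F \<Longrightarrow> P G \<Longrightarrow> P (F + G)"
    and mult: "\<And>F G. P F \<Longrightarrow> P G \<Longrightarrow> P (F * G)"
  shows "P F"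
proof -
  have 1: "P [:[:f:]:]" for f
  proof (induction f)
    case 0
    show ?case using const[of 0] by simp
  next
    case (pCons a p)
    have *: "[:[:pCons a p:]:] = [:[:[:a:]:]:] + X * [:[:p:]:]" by (simp add: X_def)
    show ?case unfolding * by (intro add mult const vars pCons.IH)
  qed
  have 2: "P [:f:]" for f
  proof (induction f)
    case 0
    show ?case using const[of 0] by simp
  next
    case (pCons a p)
    have *: "[:pCons a p:] = [:[:a:]:] + Y * [:p:]" by (simp add: Y_def)
    show ?case unfolding * by (intro add mult 1 vars pCons.IH)
  qed
  show ?thesis
  proof (induction F)
    case 0
    show ?case using const[of 0] by simp
  next
    case (pCons a p)
    have *: "pCons a p = [:a:] + Z * p" by (simp add: Z_def)
    show ?case unfolding * by (intro add mult 2 vars pCons.IH)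
  qed
qed

lemma poly3_coeff_eqI:
  fixes F G :: poly3
  assumes "\<And>a b c. coeff (coeff (coeff F c) b) a = coeff (coeff (coeff G c) b) a"
  shows "F = G"
  by (intro poly_eqI assms)

abbreviation coeff3 :: "poly3 \<Rightarrow> nat \<Rightarrow> nat \<Rightarrow> nat \<Rightarrow> complex" where
  "coeff3 F a b c \<equiv> coeff (coeff (coeff F c) b) a"

lemma monom3_eq: "monom (monom (monom \<kappa> a) b) c = scale3 \<kappa> (X ^ a * Y ^ b * Z ^ c)"
  by (rule eval3_eqI, simp) (simp add: eval3_def poly_monom)

lemma poly3_expand:
  "F = (\<Sum>c\<le>degree F. \<Sum>b\<le>degree (coeff F c). \<Sum>a\<le>degree (coeff (coeff F c) b).
         scale3 (coeff3 F a b c) (X ^ a * Y ^ b * Z ^ c))"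
proof -
  have "F = (\<Sum>c\<le>degree F. monom (\<Sum>b\<le>degree (coeff F c).
     monom (\<Sum>a\<le>degree (coeff (coeff F c) b). monom (coeff3 F a b c) a) b) c)"
    by (simp add: poly_as_sum_of_monoms)
  then show ?thesis by (simp add: monom_sum monom3_eq)
qed

section \<open>Homogeneous forms\<close>

lemma homogeneous_0 [simp]: "homogeneous d 0"
  by (simp add: homogeneous_def)

lemma homogeneous_add:
  assumes "homogeneous d F" "homogeneous d G"
  shows "homogeneous d (F + G)"
  using assms unfolding homogeneous_def by (metis add.right_neutral coeff_add)

lemma homogeneous_scale3: "homogeneous d F \<Longrightarrow> homogeneous d (scale3 \<kappa> F)"
  by (auto simp: homogeneous_def scale3_def)

lemma homogeneous_minus: "homogeneous d F \<Longrightarrow> homogeneous d (- F)"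
  by (auto simp: homogeneous_def)

lemma homogeneous_diff: "homogeneous d F \<Longrightarrow> homogeneous d G \<Longrightarrow> homogeneous d (F - G)"
  using homogeneous_add[of d F "- G"] homogeneous_minus by simp

lemma homogeneous_monomial: "homogeneous (a + b + c) (scale3 \<kappa> (X ^ a * Y ^ b * Z ^ c))"
  by (auto simp: homogeneous_def coeff_monom simp flip: monom3_eq split: if_splits)

text \<open>\<open>poly3_expand\<close> also lists monomials of other degrees, but only with
  coefficient zero; \<open>zero\<close> absorbs them.\<close>

lemma homogeneous_induct [consumes 1, case_names zero add monomial]:
  assumes hom: "homogeneous d F"
    and zero: "P 0"
    and add: "\<And>F G. P F \<Longrightarrow> P G \<Longrightarrow> P (F + G)"
    and mono: "\<And>\<kappa> a b c. a + b + c = d \<Longrightarrow> P (scale3 \<kappa> (X ^ a * Y ^ b * Z ^ c))"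
  shows "P F"
proof -
  have P_sum: "P (sum f A)" if "\<And>i. P (f i)" for f and A :: "nat set"
    by (induction A rule: infinite_finite_induct) (auto intro: zero add that)
  have "P (scale3 (coeff3 F a b c) (X ^ a * Y ^ b * Z ^ c))" for a b c
  proof (cases "coeff3 F a b c = 0")
    case True
    then show ?thesis using zero by (simp add: scale3_def)
  next
    case False
    then show ?thesis using mono hom unfolding homogeneous_def by blast
  qed
  then show ?thesis by (subst poly3_expand) (intro P_sum)
qed

lemma homogeneous_mult:
  assumes "homogeneous d F" "homogeneous e G"
  shows "homogeneous (d + e) (F * G)"
  using assms(1)
proof (induction rule: homogeneous_induct)
  case zero
  show ?case by simp
next
  case (add F G)
  then show ?case by (simp add: distrib_right homogeneous_add)
next
  case (monomial \<kappa> a b c)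
  note abc = monomial
  from assms(2) show ?case
  proof (induction rule: homogeneous_induct)
    case zero
    show ?case by simp
  next
    case (add F G)
    then show ?case by (simp add: distrib_left homogeneous_add)
  next
    case (monomial \<mu> a' b' c')
    have "scale3 \<kappa> (X ^ a * Y ^ b * Z ^ c) * scale3 \<mu> (X ^ a' * Y ^ b' * Z ^ c')
        = scale3 (\<kappa> * \<mu>) (X ^ (a + a') * Y ^ (b + b') * Z ^ (c + c'))"
      by (rule eval3_eqI) (simp add: power_add)
    moreover have "d + e = (a + a') + (b + b') + (c + c')" using abc monomial by simp
    ultimately show ?case using homogeneous_monomial by simp
  qed
qed

lemma homogeneous_const: "homogeneous 0 [:[:[:\<kappa>:]:]:]"
  by (auto simp: homogeneous_def coeff_pCons split: nat.splits)

lemma homogeneous_1: "homogeneous 0 1"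
  using homogeneous_const[of 1] by (simp add: one_pCons)

lemma homogeneous_vars: "homogeneous 1 X" "homogeneous 1 Y" "homogeneous 1 Z"
  using homogeneous_monomial[of 1 0 0 1] homogeneous_monomial[of 0 1 0 1]
    homogeneous_monomial[of 0 0 1 1] by simp_all

lemma homogeneous_power: "homogeneous d F \<Longrightarrow> homogeneous (d * k) (F ^ k)"
  by (induction k) (auto simp: homogeneous_1 intro: homogeneous_mult)

lemma homogeneous_prod:
  "(\<And>i. i \<in> A \<Longrightarrow> homogeneous (d i) (f i)) \<Longrightarrow> homogeneous (sum d A) (prod f A)"
  by (induction A rule: infinite_finite_induct) (auto simp: homogeneous_1 intro: homogeneous_mult)

lemma eval3_homogeneous: "homogeneous d F \<Longrightarrow> eval3 F (t *s v) = t ^ d * eval3 F v"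
  by (induction rule: homogeneous_induct)
     (auto simp: algebra_simps power_mult_distrib power_add)

section \<open>Restriction of forms to lines\<close>

lemma coeff_mult_bounded_degrees:
  fixes p q :: "'a::comm_semiring_0 poly"
  assumes "degree p \<le> a" "degree q \<le> b"
  shows "coeff (p * q) (a + b) = coeff p a * coeff q b"
proof -
  have "coeff p i * coeff q (a + b - i) = (if i = a then coeff p a * coeff q b else 0)"
    if "i \<le> a + b" for i
    using assms that
    by (cases i a rule: linorder_cases) (auto simp: coeff_eq_0)
  then have "coeff (p * q) (a + b) = (\<Sum>i\<le>a + b. if i = a then coeff p a * coeff q b else 0)"
    unfolding coeff_mult by (intro sum.cong) auto
  then show ?thesis by simp
qed

lemma coeff_linear_power: "coeff ([:x, y:] ^ k) k = (y::'a::comm_semiring_1) ^ k"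
  and degree_linear_power_le: "degree ([:x, y:] ^ k) \<le> k"
proof -
  show deg: "degree ([:x, y:] ^ k) \<le> k" for k :: nat
    by (rule order.trans[OF degree_power_le]) (simp add: degree_pCons_le)
  show "coeff ([:x, y:] ^ k) k = y ^ k"
  proof (induction k)
    case (Suc k)
    have "coeff ([:x, y:] * [:x, y:] ^ k) (1 + k) = coeff [:x, y:] 1 * coeff ([:x, y:] ^ k) k"
      by (rule coeff_mult_bounded_degrees) (auto intro: deg)
    then show ?case using Suc by simp
  qed simp
qed

text \<open>The coefficient of degree \<open>d\<close> is the value at \<open>v\<close>, the point
  at infinity of the parametrised line. In this way \<open>v\<close> can be counted among the
  roots.\<close>

lemma restrict_to_line:
  assumes "homogeneous d F"
  obtains f where "degree f \<le> d" "coeff f d = eval3 F v" "\<And>t. poly f t = eval3 F (u + t *s v)"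
proof -
  have "\<exists>f. degree f \<le> d \<and> coeff f d = eval3 F v \<and> (\<forall>t. poly f t = eval3 F (u + t *s v))"
    using assms
  proof (induction rule: homogeneous_induct)
    case zero
    show ?case by (intro exI[of _ 0]) simp
  next
    case (add F G)
    then obtain f g where
      "degree f \<le> d \<and> coeff f d = eval3 F v \<and> (\<forall>t. poly f t = eval3 F (u + t *s v))"
      "degree g \<le> d \<and> coeff g d = eval3 G v \<and> (\<forall>t. poly g t = eval3 G (u + t *s v))"
      by blast
    then show ?case by (intro exI[of _ "f + g"]) (simp add: degree_add_le)
  next
    case (monomial \<kappa> a b c)
    let ?l = "\<lambda>i. [:u $ i, v $ i:]"
    have 1: "degree (?l 1 ^ a * ?l 2 ^ b) \<le> a + b"
      by (rule order.trans[OF degree_mult_le]) (intro add_mono degree_linear_power_le)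
    have 2: "degree (?l 1 ^ a * ?l 2 ^ b * ?l 3 ^ c) \<le> a + b + c"
      by (rule order.trans[OF degree_mult_le]) (intro add_mono degree_linear_power_le 1)
    have 3: "coeff (?l 1 ^ a * ?l 2 ^ b * ?l 3 ^ c) (a + b + c)
        = (v $ 1) ^ a * (v $ 2) ^ b * (v $ 3) ^ c"
      by (simp add: coeff_mult_bounded_degrees 1 degree_linear_power_le coeff_linear_power)
    show ?case
      using 2 3 monomial
      by (intro exI[of _ "smult \<kappa> (?l 1 ^ a * ?l 2 ^ b * ?l 3 ^ c)"])
        (auto intro: order.trans[OF degree_smult_le])
  qed
  then show ?thesis using that by blast
qed

text \<open>Root counting on the line through \<open>u\<close> and \<open>v\<close>. In the second
  alternative the point \<open>v\<close> stands in for one affine zero, since it kills the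
  coefficient of degree \<open>d\<close>.\<close>

lemma vanishes_on_line:
  assumes hom: "homogeneous d F"
    and S: "finite S" "\<And>t. t \<in> S \<Longrightarrow> eval3 F (u + t *s v) = 0"
    and card: "card S > d \<or> card S \<ge> d \<and> eval3 F v = 0"
  shows "eval3 F (s *s u + t *s v) = 0"
proof -
  obtain f where f: "degree f \<le> d" "coeff f d = eval3 F v"
    "\<And>t. poly f t = eval3 F (u + t *s v)"
    by (rule restrict_to_line[OF hom, of v u]) blast
  have "f = 0"
  proof (rule ccontr)
    assume "f \<noteq> 0"
    then have "card {x. poly f x = 0} \<le> degree f" "finite {x. poly f x = 0}"
      using card_poly_roots_bound poly_roots_finite by auto
    moreover have "S \<subseteq> {x. poly f x = 0}" using S f by auto
    ultimately have "card S \<le> degree f" by (meson card_mono order.trans)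
    with card f have "degree f = d" "coeff f d = 0" by auto
    with \<open>f \<noteq> 0\<close> show False by auto
  qed
  then have v: "eval3 F v = 0" and uv: "eval3 F (u + t *s v) = 0" for t
    using f by (auto simp flip: f(3))
  show ?thesis
  proof (cases "s = 0")
    case True
    then show ?thesis using v eval3_homogeneous[OF hom] by simp
  next
    case False
    then have "s *s u + t *s v = s *s (u + (t / s) *s v)"
      by (simp add: vec_eq_iff field_simps)
    then show ?thesis using uv eval3_homogeneous[OF hom] by simp
  qed
qed


section \<open>Partial derivatives and multiplicity\<close>

text \<open>A derivation of the coefficients acts on polynomials as a derivation. This is the
  product rule for the inner variables, where \<open>partial\<close> is a
  \<open>map_poly\<close>.\<close>

lemma map_poly_derivation_mult:
  fixes d :: "'a::comm_ring_1 \<Rightarrow> 'a"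
  assumes add: "\<And>x y. d (x + y) = d x + d y" and mult: "\<And>x y. d (x * y) = d x * y + x * d y"
  shows "map_poly d (p * q) = map_poly d p * q + p * map_poly d q"
proof (rule poly_eqI)
  fix n
  have d0: "d 0 = 0" using add[of 0 0] by simp
  have d_sum: "d (sum f A) = (\<Sum>i\<in>A. d (f i))" for f and A :: "nat set"
    by (induction A rule: infinite_finite_induct) (simp_all add: d0 add)
  show "coeff (map_poly d (p * q)) n = coeff (map_poly d p * q + p * map_poly d q) n"
    by (simp add: coeff_map_poly d0 coeff_mult d_sum mult sum.distrib)
qed

lemma map_poly_additive:
  fixes d :: "'a::comm_ring_1 \<Rightarrow> 'a"
  assumes "\<And>x y. d (x + y) = d x + d y"
  shows "map_poly d (p + q) = map_poly d p + map_poly d q"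
proof -
  have "d 0 = 0" using assms[of 0 0] by simp
  then show ?thesis by (intro poly_eqI) (simp add: coeff_map_poly assms)
qed

lemma partial_add [simp]: "partial i (F + G) = partial i F + partial i G"
  by (simp add: partial_def pderiv_add map_poly_additive)

lemma partial_diff [simp]: "partial i (F - G) = partial i F - partial i G"
  using partial_add[of i "F - G" G] by simp

lemma pderiv_mult': "pderiv (p * q) = pderiv p * q + p * pderiv q"
  by (simp add: pderiv_mult algebra_simps)

lemma partial_mult [simp]: "partial i (F * G) = partial i F * G + F * partial i G"
  by (simp add: partial_def pderiv_add map_poly_additive map_poly_derivation_mult pderiv_mult'
      del: mult_pCons_left mult_pCons_right)

lemma partial_const [simp]: "partial i [:[:[:\<kappa>:]:]:] = 0"
  by (simp add: partial_def map_poly_pCons pderiv_pCons)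

lemma partial_0 [simp]: "partial i 0 = 0"
  by (simp add: partial_def)

lemma partial_vars [simp]:
  "partial 1 X = 1" "partial 1 Y = 0" "partial 1 Z = 0"
  "partial 2 X = 0" "partial 2 Y = 1" "partial 2 Z = 0"
  "partial 3 X = 0" "partial 3 Y = 0" "partial 3 Z = 1"
  by (simp_all add: partial_def X_def Y_def Z_def map_poly_pCons pderiv_pCons one_pCons)

lemma scale3_eq_mult: "scale3 \<kappa> F = [:[:[:\<kappa>:]:]:] * F"
  by (simp add: scale3_def)

lemma partial_scale3 [simp]: "partial i (scale3 \<kappa> F) = scale3 \<kappa> (partial i F)"
  unfolding scale3_eq_mult by (subst partial_mult) simp

lemma coeff3_partial:
  "coeff3 (partial 1 F) a b c = of_nat (Suc a) * coeff3 F (Suc a) b c"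
  "coeff3 (partial 2 F) a b c = of_nat (Suc b) * coeff3 F a (Suc b) c"
  "coeff3 (partial 3 F) a b c = of_nat (Suc c) * coeff3 F a b (Suc c)"
  by (simp_all add: partial_def coeff_map_poly coeff_pderiv of_nat_poly)

lemma partial_commute: "partial i (partial j F) = partial j (partial i F)"
proof -
  have "partial 1 (partial 2 F) = partial 2 (partial 1 F)"
    "partial 1 (partial 3 F) = partial 3 (partial 1 F)"
    "partial 2 (partial 3 F) = partial 3 (partial 2 F)"
    by (rule poly3_coeff_eqI, simp only: coeff3_partial mult.left_commute)+
  then show ?thesis using exhaust_3[of i] exhaust_3[of j] by metis
qed

lemma homogeneous_partial:
  assumes "homogeneous d F"
  shows "homogeneous (d - 1) (partial i F)"
proof -
  have "a + b + c = d - 1" if "coeff3 (partial i F) a b c \<noteq> 0" for a b c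
    using exhaust_3[of i] that assms
    by (elim disjE) (fastforce simp: coeff3_partial homogeneous_def simp del: of_nat_Suc)+
  then show ?thesis by (simp add: homogeneous_def)
qed

lemma homogeneous_foldr_partial:
  "homogeneous d F \<Longrightarrow> homogeneous (d - length is) (foldr partial is F)"
  by (induction "is") (auto dest: homogeneous_partial)

section \<open>Directional derivatives and forms of high multiplicity\<close>

definition dir_deriv :: "complex ^ 3 \<Rightarrow> poly3 \<Rightarrow> poly3" where
  "dir_deriv v F =
     scale3 (v $ 1) (partial 1 F) + scale3 (v $ 2) (partial 2 F) + scale3 (v $ 3) (partial 3 F)"

lemma homogeneous_dir_deriv: "homogeneous d F \<Longrightarrow> homogeneous (d - 1) (dir_deriv v F)"
  unfolding dir_deriv_def by (intro homogeneous_add homogeneous_scale3 homogeneous_partial)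

lemma partial_dir_deriv: "partial i (dir_deriv v F) = dir_deriv v (partial i F)"
  unfolding dir_deriv_def by (simp add: partial_commute[of i])

lemma foldr_partial_dir_deriv:
  "foldr partial is (dir_deriv v F) = dir_deriv v (foldr partial is F)"
  by (induction "is") (simp_all add: partial_dir_deriv)

text \<open>Identifies the formal derivative with the analytic one, so that a vanishing derivative
  forces constancy along a line.\<close>

lemma eval3_has_field_derivative:
  "((\<lambda>s. eval3 F (w + s *s v)) has_field_derivative eval3 (dir_deriv v F) (w + s *s v)) (at s)"
proof (induction F rule: poly3_induct)
  case (5 F G)
  then show ?case
    by (auto simp: dir_deriv_def algebra_simps intro!: derivative_eq_intros)
next
  case (6 F G)
  then show ?case
    by (auto simp: dir_deriv_def algebra_simps intro!: derivative_eq_intros)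
qed (auto simp: dir_deriv_def intro!: derivative_eq_intros)

text \<open>Both sides are the derivative at \<open>s = 0\<close> of the value at
  \<open>v + s *s v\<close>, which is \<open>(1 + s) ^ d * eval3 F v\<close>.\<close>

lemma euler_identity:
  assumes "homogeneous d F"
  shows "eval3 (dir_deriv v F) v = of_nat d * eval3 F v"
proof -
  have "v + s *s v = (1 + s) *s v" for s by (simp add: vec_eq_iff algebra_simps)
  then have "((\<lambda>s. (1 + s) ^ d * eval3 F v) has_field_derivative eval3 (dir_deriv v F) v) (at 0)"
    using eval3_has_field_derivative[of F v v 0] eval3_homogeneous[OF assms] by simp
  moreover have "((\<lambda>s. (1 + s) ^ d * eval3 F v) has_field_derivative of_nat d * eval3 F v) (at 0)"
    by (auto intro!: derivative_eq_intros)
  ultimately show ?thesis by (rule DERIV_unique)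
qed

text \<open>Induction on \<open>d\<close>: the first partials satisfy the hypothesis in degree one
  less, hence are zero, and Euler's identity then makes a nonzero multiple of \<open>F\<close>
  vanish.\<close>

lemma homogeneous_eq_0_if_all_partials_vanish:
  assumes "homogeneous d F" "\<And>is. length is \<le> d \<Longrightarrow> eval3 (foldr partial is F) v = 0"
  shows "F = 0"
  using assms
proof (induction d arbitrary: F)
  case 0
  show ?case
  proof (rule eval3_eq_0)
    fix w
    have "eval3 F w = eval3 F v"
      using eval3_homogeneous[OF 0(1), of 0 w] eval3_homogeneous[OF 0(1), of 0 v] by simp
    then show "eval3 F w = 0" using 0(2)[of "[]"] by simp
  qed
next
  case (Suc d)
  have "partial i F = 0" for i
  proof (rule Suc.IH)
    show "homogeneous d (partial i F)" using homogeneous_partial[OF Suc.prems(1)] by simp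
    show "eval3 (foldr partial is (partial i F)) v = 0" if "length is \<le> d" for "is"
      using Suc.prems(2)[of "is @ [i]"] that by simp
  qed
  then have "dir_deriv w F = 0" for w by (simp add: dir_deriv_def scale3_def)
  then show ?case
    using euler_identity[OF Suc.prems(1)] by (intro eval3_eq_0) (simp del: of_nat_Suc)
qed

text \<open>The second derivative has degree \<open>d - 2\<close>, so its derivatives of order up to
  \<open>d - 2\<close> at \<open>v\<close> decide whether it is zero. Euler's identity, applied
  twice, makes each of them a multiple of the same derivative of \<open>F\<close>, whose order is
  below \<open>d - 1\<close>.\<close>

lemma second_dir_deriv_eq_0:
  assumes hom: "homogeneous d F" and "d \<ge> 2"
    and van: "\<And>is. length is < d - 1 \<Longrightarrow> eval3 (foldr partial is F) v = 0"
  shows "dir_deriv v (dir_deriv v F) = 0"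
proof (rule homogeneous_eq_0_if_all_partials_vanish)
  show "homogeneous (d - 1 - 1) (dir_deriv v (dir_deriv v F))"
    by (intro homogeneous_dir_deriv hom)
  fix "is" :: "3 list"
  assume "length is \<le> d - 1 - 1"
  then have "eval3 (foldr partial is F) v = 0" using van[of "is"] \<open>d \<ge> 2\<close> by simp
  then show "eval3 (foldr partial is (dir_deriv v (dir_deriv v F))) v = 0"
    using homogeneous_foldr_partial[OF hom, of "is"]
    by (simp add: foldr_partial_dir_deriv euler_identity[OF homogeneous_dir_deriv] euler_identity)
qed

text \<open>A function with zero derivative is constant. This applies first to
  \<open>dir_deriv v F\<close> along \<open>v\<close>, and then to \<open>F\<close> minus its linear
  term.\<close>

lemma affine_in_direction:
  assumes "homogeneous d F" "d \<ge> 2"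
    and "\<And>is. length is < d - 1 \<Longrightarrow> eval3 (foldr partial is F) v = 0"
  shows "eval3 F (w + s *s v) = eval3 F w + s * eval3 (dir_deriv v F) w"
proof -
  have "((\<lambda>s. eval3 (dir_deriv v F) (w + s *s v)) has_field_derivative 0) (at s)" for s
    using eval3_has_field_derivative[of "dir_deriv v F" w v] second_dir_deriv_eq_0[OF assms] by simp
  then have "\<exists>c. \<forall>s\<in>UNIV. eval3 (dir_deriv v F) (w + s *s v) = c"
    by (intro has_field_derivative_zero_constant) auto
  then have 1: "eval3 (dir_deriv v F) (w + s *s v) = eval3 (dir_deriv v F) w" for s
    by (metis UNIV_I add.right_neutral vector_smult_lzero)
  have "((\<lambda>s. eval3 F (w + s *s v) - s * eval3 (dir_deriv v F) w) has_field_derivative 0) (at s)" for s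
    using eval3_has_field_derivative[of F w v s] 1 by (auto intro!: derivative_eq_intros)
  then have "\<exists>c. \<forall>s\<in>UNIV. eval3 F (w + s *s v) - s * eval3 (dir_deriv v F) w = c"
    by (intro has_field_derivative_zero_constant) auto
  then have "eval3 F (w + s *s v) - s * eval3 (dir_deriv v F) w
      = eval3 F (w + 0 *s v) - 0 * eval3 (dir_deriv v F) w" by (metis UNIV_I)
  then show ?thesis by (simp add: algebra_simps)
qed

lemma foldr_partial_add: "foldr partial is (F + G) = foldr partial is F + foldr partial is G"
  by (induction "is") simp_all

text \<open>Each derivative removes at most one factor \<open>L\<close>, so after fewer than
  \<open>k\<close> of them a factor vanishing at \<open>v\<close> survives.\<close>

lemma eval3_foldr_partial_power:
  assumes "eval3 L v = 0" "length is < k"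
  shows "eval3 (foldr partial is (A * L ^ k)) v = 0"
proof -
  have 1: "\<exists>C. partial i (L ^ Suc k) = C * L ^ k" for i k
  proof (induction k)
    case 0
    show ?case by simp
  next
    case (Suc k)
    then obtain C where "partial i (L ^ Suc k) = C * L ^ k" by blast
    then have "partial i (L ^ Suc (Suc k)) = (partial i L + C) * L ^ Suc k"
      by (subst power_Suc) (simp add: algebra_simps del: partial_mult, simp add: algebra_simps)
    then show ?case by blast
  qed
  have "length is \<le> k \<Longrightarrow> \<exists>B. foldr partial is (A * L ^ k) = B * L ^ (k - length is)"
  proof (induction "is")
    case Nil
    show ?case by auto
  next
    case (Cons i "is")
    then obtain B where B: "foldr partial is (A * L ^ k) = B * L ^ (k - length is)" by auto
    have "k - length is = Suc (k - length (i # is))" using Cons by simp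
    moreover obtain C where "partial i (L ^ Suc (k - length (i # is))) = C * L ^ (k - length (i # is))"
      using 1 by blast
    ultimately have "foldr partial (i # is) (A * L ^ k)
        = (partial i B * L + B * C) * L ^ (k - length (i # is))"
      by (simp add: B algebra_simps del: power_Suc) (simp add: algebra_simps)
    then show ?case by blast
  qed
  then obtain B where "foldr partial is (A * L ^ k) = B * L ^ (k - length is)" using assms by auto
  then show ?thesis using assms by (simp add: power_0_left)
qed


section \<open>Generic points, and irreducibility\<close>

lemma homogeneous_coords_abs:
  assumes "v \<noteq> 0"
  shows "homogeneous_coords (abs_proj_plane v) w \<longleftrightarrow> (\<exists>c. c \<noteq> 0 \<and> w = c *s v)"
proof -
  have refl: "proportional u u" if "u \<noteq> 0" for u
    using that unfolding proportional_def by (auto intro!: exI[of _ 1])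
  have "homogeneous_coords (abs_proj_plane v) w \<longleftrightarrow> proportional v w"
    using Quotient3_rel[OF Quotient3_proj_plane, of v w] refl assms
    unfolding homogeneous_coords_def by (metis proportional_def)
  then show ?thesis using assms by (auto simp: proportional_def)
qed

lemma proj_plane_cases:
  obtains v where "v \<noteq> 0" "p = abs_proj_plane v"
proof -
  have "proportional (rep_proj_plane p) (rep_proj_plane p)" "abs_proj_plane (rep_proj_plane p) = p"
    using Quotient3_rep_reflp[OF Quotient3_proj_plane] Quotient3_abs_rep[OF Quotient3_proj_plane]
    by auto
  then show ?thesis using that[of "rep_proj_plane p"] by (simp add: proportional_def)
qed

lemma vanishes_at_abs:
  assumes "homogeneous d F" "v \<noteq> 0"
  shows "vanishes_at F (abs_proj_plane v) \<longleftrightarrow> eval3 F v = 0"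
  unfolding vanishes_at_def homogeneous_coords_abs[OF assms(2)]
  using eval3_homogeneous[OF assms(1)]
  by (metis mult_zero_right vector_smult_lid zero_neq_one)

lemma incident_abs:
  assumes "u \<noteq> 0" "v \<noteq> 0"
  shows "incident (abs_proj_plane u) (abs_proj_plane v) \<longleftrightarrow>
    u $ 1 * v $ 1 + u $ 2 * v $ 2 + u $ 3 * v $ 3 = 0"
proof -
  have "proportional u u" "proportional v v"
    using assms unfolding proportional_def by (auto intro!: exI[of _ 1])
  then show ?thesis by (rule incident.abs_eq)
qed

text \<open>A point outside \<open>zero_locus S\<close> is already excluded by a single form of
  \<open>S\<close>, so every nonempty open set contains the complement of the zero locus of one
  nonzero form.\<close>

lemma generically_iff:
  "generically P \<longleftrightarrow> (\<exists>d H. homogeneous d H \<and> H \<noteq> 0 \<and>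
      (\<forall>v. v \<noteq> 0 \<longrightarrow> eval3 H v \<noteq> 0 \<longrightarrow> P (abs_proj_plane v)))"
proof
  assume "generically P"
  then obtain S q where S: "\<And>F. F \<in> S \<Longrightarrow> \<exists>d. homogeneous d F"
    and q: "q \<notin> zero_locus S" and P: "\<And>p. p \<notin> zero_locus S \<Longrightarrow> P p"
    unfolding generically_def zariski_open_def zariski_closed_def by blast
  obtain H where H: "H \<in> S" "\<not> vanishes_at H q" using q by (auto simp: zero_locus_def)
  obtain d where d: "homogeneous d H" using S H by blast
  have "H \<noteq> 0" using H by (auto simp: vanishes_at_def)
  moreover have "P (abs_proj_plane v)" if "v \<noteq> 0" "eval3 H v \<noteq> 0" for v
    by (rule P) (use that H vanishes_at_abs[OF d] in \<open>auto simp: zero_locus_def\<close>)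
  ultimately show "\<exists>d H. homogeneous d H \<and> H \<noteq> 0 \<and>
      (\<forall>v. v \<noteq> 0 \<longrightarrow> eval3 H v \<noteq> 0 \<longrightarrow> P (abs_proj_plane v))"
    using d by blast
next
  assume "\<exists>d H. homogeneous d H \<and> H \<noteq> 0 \<and>
      (\<forall>v. v \<noteq> 0 \<longrightarrow> eval3 H v \<noteq> 0 \<longrightarrow> P (abs_proj_plane v))"
  then obtain d H where H: "homogeneous d H" "H \<noteq> 0"
    and P: "\<And>v. v \<noteq> 0 \<Longrightarrow> eval3 H v \<noteq> 0 \<Longrightarrow> P (abs_proj_plane v)" by blast
  \<comment> \<open>The factor \<open>X\<close> keeps the point with \<open>H\<close> nonzero away
    from the origin, which a constant \<open>H\<close> would allow.\<close>
  have "X \<noteq> 0" by (simp add: X_def)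
  then have "X * H \<noteq> 0" using H by simp
  then obtain v where v: "eval3 (X * H) v \<noteq> 0" using eval3_eq_0 by blast
  then have "v \<noteq> 0" by auto
  with v have "abs_proj_plane v \<notin> zero_locus {H}"
    by (simp add: zero_locus_def vanishes_at_abs[OF H(1)])
  moreover have "P q" if "q \<notin> zero_locus {H}" for q
    by (rule proj_plane_cases[of q])
       (use that P vanishes_at_abs[OF H(1)] in \<open>auto simp: zero_locus_def\<close>)
  moreover have "zariski_open (- zero_locus {H})"
    unfolding zariski_open_def zariski_closed_def using H by (auto intro!: exI[of _ "{H}"])
  ultimately show "generically P"
    unfolding generically_def by (intro exI[of _ "- zero_locus {H}"]) auto
qed

lemma generically_conj:
  assumes "generically P" "generically Q"
  shows "generically (\<lambda>q. P q \<and> Q q)"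
proof -
  obtain d H e K where
    "homogeneous d H" "H \<noteq> 0" "\<And>v. v \<noteq> 0 \<Longrightarrow> eval3 H v \<noteq> 0 \<Longrightarrow> P (abs_proj_plane v)"
    "homogeneous e K" "K \<noteq> 0" "\<And>v. v \<noteq> 0 \<Longrightarrow> eval3 K v \<noteq> 0 \<Longrightarrow> Q (abs_proj_plane v)"
    using assms unfolding generically_iff by blast
  then show ?thesis
    unfolding generically_iff
    by (intro exI[of _ "d + e"] exI[of _ "H * K"]) (simp add: homogeneous_mult)
qed

lemma generically_imp_ex: "generically P \<Longrightarrow> \<exists>q. P q"
  by (auto simp: generically_def)

section \<open>Irreducibility of polynomials that are affine in one direction\<close>

lemma poly_map_poly_hom:
  "poly (poly p [:y:]) x = poly (map_poly (\<lambda>r. poly r x) p) (y::complex)"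
  by (induction p) (simp_all add: map_poly_pCons)

text \<open>If \<open>A\<close> involves the outer variable, fixing a suitable
  \<open>x \<noteq> 0\<close> leaves a polynomial in \<open>y\<close> with a root; if it involves
  only \<open>x\<close>, a root \<open>x\<close> can be paired with \<open>y = 1\<close>.\<close>

lemma isolated_zero_imp_const:
  fixes A :: "complex poly poly"
  assumes "\<And>x y. poly (poly A [:y:]) x = 0 \<Longrightarrow> x = 0 \<and> y = 0"
  obtains \<kappa> where "\<kappa> \<noteq> 0" "A = [:[:\<kappa>:]:]"
proof -
  have "A \<noteq> 0" using assms[of 1 1] by auto
  have "degree A = 0"
  proof (rule ccontr)
    assume deg: "degree A \<noteq> 0"
    \<comment> \<open>The extra factor gives \<open>x \<noteq> 0\<close>, so the zero found below is
      not the origin.\<close>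
    have "lead_coeff A * [:0, 1:] \<noteq> 0" using \<open>A \<noteq> 0\<close> by simp
    then obtain x where x: "poly (lead_coeff A * [:0, 1:]) x \<noteq> 0"
      using poly_all_0_iff_0 by blast
    then have "coeff (map_poly (\<lambda>r. poly r x) A) (degree A) \<noteq> 0"
      by (simp add: coeff_map_poly)
    then have "degree (map_poly (\<lambda>r. poly r x) A) > 0"
      using deg le_degree by fastforce
    then obtain y where "poly (map_poly (\<lambda>r. poly r x) A) y = 0"
      using alg_closed_imp_poly_has_root by blast
    then show False using assms[of y x] x by (simp add: poly_map_poly_hom)
  qed
  then obtain g where g: "A = [:g:]" by (rule degree_eq_zeroE)
  have "degree g = 0"
  proof (rule ccontr)
    assume "degree g \<noteq> 0"
    then obtain x where "poly g x = 0"
      using alg_closed_imp_poly_has_root by blast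
    then show False using assms[of 1 x] g by simp
  qed
  then obtain \<kappa> where "g = [:\<kappa>:]" by (rule degree_eq_zeroE)
  with g \<open>A \<noteq> 0\<close> that show ?thesis by auto
qed

text \<open>The substitution is the linear change of coordinates that takes
  \<open>(0, 0, v $ 3)\<close> to \<open>v\<close> and fixes the plane \<open>z = 0\<close>.\<close>

lemma ex_shear:
  fixes v :: "complex ^ 3"
  assumes "v $ 3 \<noteq> 0"
  shows "\<exists>G. \<forall>w. eval3 G w = eval3 F (vector [w $ 1, w $ 2, 0] + (w $ 3 / v $ 3) *s v)"
proof (induction F rule: poly3_induct)
  case (1 \<kappa>)
  show ?case by (intro exI[of _ "[:[:[:\<kappa>:]:]:]"]) simp
next
  case 2
  show ?case
    by (intro exI[of _ "X + scale3 (v $ 1 / v $ 3) Z"]) (simp add: vector_3)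
next
  case 3
  show ?case
    by (intro exI[of _ "Y + scale3 (v $ 2 / v $ 3) Z"]) (simp add: vector_3)
next
  case 4
  show ?case
    using assms by (intro exI[of _ Z]) (simp add: vector_3)
next
  case (5 F G)
  then obtain F' G' where "\<forall>w. eval3 F' w = eval3 F (vector [w $ 1, w $ 2, 0] + (w $ 3 / v $ 3) *s v)"
    "\<forall>w. eval3 G' w = eval3 G (vector [w $ 1, w $ 2, 0] + (w $ 3 / v $ 3) *s v)" by blast
  then show ?case by (intro exI[of _ "F' + G'"]) simp
next
  case (6 F G)
  then obtain F' G' where "\<forall>w. eval3 F' w = eval3 F (vector [w $ 1, w $ 2, 0] + (w $ 3 / v $ 3) *s v)"
    "\<forall>w. eval3 G' w = eval3 G (vector [w $ 1, w $ 2, 0] + (w $ 3 / v $ 3) *s v)" by blast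
  then show ?case by (intro exI[of _ "F' * G'"]) simp
qed

lemma eval3_plane: "eval3 F (vector [x, y, 0]) = poly (poly (coeff F 0) [:y:]) x"
  by (simp add: eval3_def vector_3 poly_0_coeff_0)

lemma plane_decomposition:
  fixes w v :: "complex ^ 3"
  assumes "v $ 3 \<noteq> 0"
  shows "w = vector [w $ 1 - w $ 3 / v $ 3 * v $ 1, w $ 2 - w $ 3 / v $ 3 * v $ 2, 0] + (w $ 3 / v $ 3) *s v"
  using assms by (simp add: vec_eq_iff forall_3 vector_3)

text \<open>After the shear moving \<open>v\<close> to \<open>(0 : 0 : 1)\<close> the polynomial becomes \<open>P(x, y) + z Q(x, y)\<close>, and a
  proper factor would be a common factor of \<open>P\<close> and \<open>Q\<close>, hence have a zero other than the origin.\<close>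

lemma irreducible_if_affine_in_direction:
  fixes v :: "complex ^ 3"
  assumes v: "v $ 3 \<noteq> 0"
    and aff: "\<And>w s. eval3 F (w + s *s v) = eval3 F w + s * eval3 G w"
    and F0: "eval3 F 0 = 0"
    and iso: "\<And>x y. eval3 F (vector [x, y, 0]) = 0 \<Longrightarrow> eval3 G (vector [x, y, 0]) = 0 \<Longrightarrow> x = 0 \<and> y = 0"
  shows "irreducible F"
proof -
  obtain \<sigma> where \<sigma>: "\<And>A w. eval3 (\<sigma> A) w = eval3 A (vector [w $ 1, w $ 2, 0] + (w $ 3 / v $ 3) *s v)"
    using ex_shear[OF v] by metis
  have \<sigma>_mult: "\<sigma> (A * B) = \<sigma> A * \<sigma> B" for A B
    by (rule eval3_eqI) (simp add: \<sigma>)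
  define P where "P = coeff F 0"
  \<comment> \<open>The division by \<open>v $ 3\<close> matches the parameter
    \<open>w $ 3 / v $ 3\<close> of the shear.\<close>
  define Q where "Q = smult [:1 / v $ 3:] (coeff G 0)"
  have \<sigma>F: "\<sigma> F = [:P, Q:]"
  proof (rule eval3_eqI)
    fix w
    have "eval3 (\<sigma> F) w = eval3 F (vector [w $ 1, w $ 2, 0])
        + w $ 3 / v $ 3 * eval3 G (vector [w $ 1, w $ 2, 0])"
      by (simp add: \<sigma> aff)
    then show "eval3 (\<sigma> F) w = eval3 [:P, Q:] w"
      by (simp add: eval3_plane) (simp add: eval3_def P_def Q_def)
  qed
  have "F \<noteq> 0"
  proof
    assume "F = 0"
    then have "eval3 G w = 0" for w using aff[of w 1] by simp
    then show False using iso[of 1 1] \<open>F = 0\<close> by simp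
  qed
  \<comment> \<open>If \<open>\<sigma> A\<close> is free of \<open>z\<close>, it divides both
    \<open>P\<close> and \<open>Q\<close>, so its zeros are common zeros and \<open>iso\<close>
    leaves only the origin.\<close>
  have unit: "A dvd 1" if AB: "F = A * B" and deg: "degree (\<sigma> A) = 0" for A B
  proof -
    obtain A0 where A0: "\<sigma> A = [:A0:]" using deg by (rule degree_eq_zeroE)
    have "[:P, Q:] = smult A0 (\<sigma> B)" using \<sigma>F \<sigma>_mult AB A0 by simp
    then have PQ: "P = A0 * coeff (\<sigma> B) 0" "Q = A0 * coeff (\<sigma> B) 1"
      by (metis coeff_pCons_0 coeff_smult, metis One_nat_def coeff_pCons_0 coeff_pCons_Suc coeff_smult)
    have "x = 0 \<and> y = 0" if "poly (poly A0 [:y:]) x = 0" for x y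
    proof (rule iso)
      have "poly (poly P [:y:]) x = 0" "poly (poly Q [:y:]) x = 0" using that PQ by simp_all
      then show "eval3 F (vector [x, y, 0]) = 0" "eval3 G (vector [x, y, 0]) = 0"
        using v by (simp_all add: eval3_plane P_def Q_def)
    qed
    then obtain \<kappa> where \<kappa>: "\<kappa> \<noteq> 0" "A0 = [:[:\<kappa>:]:]" by (rule isolated_zero_imp_const)
    \<comment> \<open>Undo the shear: every \<open>w\<close> is the image of some \<open>?u\<close>,
      and \<open>\<sigma> A\<close> is constant.\<close>
    have "A = [:[:[:\<kappa>:]:]:]"
    proof (rule eval3_eqI)
      fix w :: "complex ^ 3"
      let ?u = "vector [w $ 1 - w $ 3 / v $ 3 * v $ 1, w $ 2 - w $ 3 / v $ 3 * v $ 2, w $ 3] :: complex ^ 3"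
      have "eval3 A w = eval3 (\<sigma> A) ?u"
        by (subst plane_decomposition[OF v, of w]) (simp only: \<sigma> vector_3)
      then show "eval3 A w = eval3 [:[:[:\<kappa>:]:]:] w" by (simp add: A0 \<kappa>)
    qed
    then have "A * [:[:[:1 / \<kappa>:]:]:] = 1" using \<kappa> by (intro eval3_eqI) simp
    then show ?thesis by (metis dvd_triv_left)
  qed
  show ?thesis
  proof (rule irreducibleI)
    show "F \<noteq> 0" by fact
    show "\<not> F dvd 1"
    proof
      assume "F dvd 1"
      then obtain K where "1 = F * K" by (elim dvdE)
      then have "eval3 1 0 = eval3 F 0 * eval3 K 0" by (metis eval3_simps(6))
      then show False using F0 by simp
    qed
    fix A B assume AB: "F = A * B"
    have "\<sigma> F \<noteq> 0" using \<sigma>F \<open>F \<noteq> 0\<close> iso[of 1 1] v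
      by (auto simp: P_def Q_def eval3_plane)
    \<comment> \<open>In \<open>z\<close> the product has degree at most 1, so one of the factors is
      free of \<open>z\<close>.\<close>
    then have "degree (\<sigma> A) + degree (\<sigma> B) = degree [:P, Q:]"
      using \<sigma>_mult AB \<sigma>F by (metis degree_mult_eq mult_eq_0_iff)
    also have "\<dots> \<le> 1" by simp
    finally have "degree (\<sigma> A) = 0 \<or> degree (\<sigma> B) = 0" by linarith
    then show "A dvd 1 \<or> B dvd 1"
      using unit[of A B] unit[of B A] AB by (auto simp: mult.commute)
  qed
qed


section \<open>The dual point set\<close>

text \<open>The dual points on the side \<open>z = 0\<close> of the coordinate triangle: two vertices and \<open>n\<close> further points.\<close>

definition on_side :: "nat \<Rightarrow> complex \<Rightarrow> complex \<Rightarrow> complex \<Rightarrow> bool" where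
  "on_side n x y z \<longleftrightarrow> z = 0 \<and> (x = 0 \<or> y = 0 \<or> x ^ n = (- y) ^ n)"

definition dual_vec :: "nat \<Rightarrow> complex ^ 3 \<Rightarrow> bool" where
  "dual_vec n h \<longleftrightarrow> on_side n (h $ 1) (h $ 2) (h $ 3) \<or> on_side n (h $ 2) (h $ 3) (h $ 1)
     \<or> on_side n (h $ 3) (h $ 1) (h $ 2)"

lemma eval3_full_monomial_poly:
  "eval3 (full_monomial_poly m) r = r $ 1 * r $ 2 * r $ 3 * ((r $ 1) ^ (m - 2) - (r $ 2) ^ (m - 2))
     * ((r $ 2) ^ (m - 2) - (r $ 3) ^ (m - 2)) * ((r $ 3) ^ (m - 2) - (r $ 1) ^ (m - 2))"
  by (simp add: full_monomial_poly_def)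

lemma abs_mem_full_monomial_dual_iff:
  assumes "h \<noteq> 0"
  shows "abs_proj_plane h \<in> full_monomial_dual m \<longleftrightarrow>
    (\<forall>r. h $ 1 * r $ 1 + h $ 2 * r $ 2 + h $ 3 * r $ 3 = 0 \<longrightarrow> eval3 (full_monomial_poly m) r = 0)"
proof -
  have "abs_proj_plane h \<in> full_monomial_dual m \<longleftrightarrow>
      (\<forall>p. incident (abs_proj_plane h) p \<longrightarrow> vanishes_at (full_monomial_poly m) p)"
    by (auto simp: full_monomial_dual_def dual_points_def arrangement_def is_line_def dual_line_def
        zero_locus_def)
  also have "\<dots> \<longleftrightarrow> (\<forall>p r. r \<noteq> 0 \<longrightarrow> p = abs_proj_plane r \<longrightarrow> incident (abs_proj_plane h) p
      \<longrightarrow> eval3 (full_monomial_poly m) r = 0)"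
    unfolding vanishes_at_def homogeneous_coords_def by blast
  also have "\<dots> \<longleftrightarrow> (\<forall>r. r \<noteq> 0 \<longrightarrow> h $ 1 * r $ 1 + h $ 2 * r $ 2 + h $ 3 * r $ 3 = 0
      \<longrightarrow> eval3 (full_monomial_poly m) r = 0)"
    using incident_abs[OF assms] by auto
  also have "\<dots> \<longleftrightarrow> (\<forall>r. h $ 1 * r $ 1 + h $ 2 * r $ 2 + h $ 3 * r $ 3 = 0
      \<longrightarrow> eval3 (full_monomial_poly m) r = 0)"
  proof -
    have "eval3 (full_monomial_poly m) 0 = 0" by (simp add: eval3_full_monomial_poly)
    then show ?thesis by metis
  qed
  finally show ?thesis .
qed

text \<open>If \<open>a\<close> and \<open>b\<close> are nonzero, \<open>a x = - b y\<close> and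
  \<open>a^n = (- b)^n\<close> give \<open>x^n = y^n\<close>; otherwise \<open>x\<close> or
  \<open>y\<close> is zero.\<close>

lemma on_sideD:
  assumes "on_side n a b c" "a * x + b * y + c * z = 0" "a \<noteq> 0 \<or> b \<noteq> 0 \<or> c \<noteq> 0"
  shows "x * y * (x ^ n - y ^ n) = (0::complex)"
proof (cases "a = 0 \<or> b = 0")
  case True
  then show ?thesis using assms by (auto simp: on_side_def)
next
  case False
  with assms have c: "a \<noteq> 0" "a ^ n = (- b) ^ n" "a * x = - b * y"
    by (auto simp: on_side_def eq_neg_iff_add_eq_0)
  then have "a ^ n * x ^ n = a ^ n * y ^ n"
    by (metis power_mult_distrib)
  with c False show ?thesis by simp
qed

text \<open>The points \<open>(s, 1, \<alpha> s + \<beta>)\<close> run along the line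
  \<open>z = \<alpha> x + \<beta> y\<close>. A product of polynomials in \<open>s\<close> that
  vanishes identically has a zero factor.\<close>

lemma affine_line_in_arrangement:
  fixes \<alpha> \<beta> :: complex
  assumes "n > 0"
    and zero: "\<And>s. s * (\<alpha> * s + \<beta>) * (s ^ n - 1) * (1 - (\<alpha> * s + \<beta>) ^ n)
        * ((\<alpha> * s + \<beta>) ^ n - s ^ n) = 0"
  shows "\<alpha> = 0 \<and> \<beta> = 0 \<or> \<alpha> = 0 \<and> \<beta> ^ n = 1 \<or> \<beta> = 0 \<and> \<alpha> ^ n = 1"
proof -
  let ?x = "[:0, 1:] :: complex poly" and ?z = "[:\<beta>, \<alpha>:]"
  have "poly (?x * ?z * (?x ^ n - 1) * (1 - ?z ^ n) * (?z ^ n - ?x ^ n)) s = 0" for s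
    using zero[of s] by (simp add: algebra_simps)
  then have "?x * ?z * (?x ^ n - 1) * (1 - ?z ^ n) * (?z ^ n - ?x ^ n) = 0"
    using poly_all_0_iff_0 by blast
  then have "?z = 0 \<or> ?x ^ n - 1 = 0 \<or> 1 - ?z ^ n = 0 \<or> ?z ^ n - ?x ^ n = 0"
    unfolding mult_eq_0_iff by auto
  then consider "?z = 0" | "?x ^ n = 1" | "?z ^ n = 1" | "?z ^ n = ?x ^ n" by auto
  then show ?thesis
  proof cases
    case 1
    then show ?thesis by simp
  next
    case 2
    then have "poly (?x ^ n) 0 = 1" by simp
    then show ?thesis using \<open>n > 0\<close> by (simp add: zero_power)
  next
    case 3
    then have "poly (?z ^ n) 0 = 1" by simp
    then have \<beta>: "\<beta> ^ n = 1" by simp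
    then have "?z \<noteq> 0" using \<open>n > 0\<close> by (auto simp: zero_power)
    then have "n * degree ?z = 0" using 3 by (metis degree_1 degree_power_eq)
    then show ?thesis using \<beta> \<open>n > 0\<close> by (simp split: if_splits)
  next
    case 4
    then have "poly (?z ^ n) 0 = poly (?x ^ n) 0" "poly (?z ^ n) 1 = poly (?x ^ n) 1" by simp_all
    then show ?thesis using \<open>n > 0\<close> by (simp add: zero_power)
  qed
qed

lemma dual_vec_if_line_in_arrangement:
  assumes n: "n > 0" and h: "h \<noteq> 0"
    and line: "\<And>x y z. h $ 1 * x + h $ 2 * y + h $ 3 * z = 0 \<Longrightarrow>
        x * y * z * (x ^ n - y ^ n) * (y ^ n - z ^ n) * (z ^ n - x ^ n) = 0"
  shows "dual_vec n h"
proof (cases "h $ 3 = 0")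
  case True
  \<comment> \<open>The line passes through \<open>(0 : 0 : 1)\<close>, so over
    \<open>x = h $ 2\<close>, \<open>y = - h $ 1\<close> the coordinate \<open>z\<close> is free.
    The factors involving \<open>z\<close> are nonzero polynomials, hence the constant one
    vanishes.\<close>
  let ?a = "h $ 2" and ?b = "- h $ 1" and ?x = "[:0, 1:] :: complex poly"
  have "poly (smult (?a * ?b * (?a ^ n - ?b ^ n)) (?x * ([:?b ^ n:] - ?x ^ n) * (?x ^ n - [:?a ^ n:]))) z = 0" for z
    using line[of ?a ?b z] True by (simp add: algebra_simps)
  then have "smult (?a * ?b * (?a ^ n - ?b ^ n)) (?x * ([:?b ^ n:] - ?x ^ n) * (?x ^ n - [:?a ^ n:])) = 0"
    using poly_all_0_iff_0 by blast
  moreover have "?x ^ n \<noteq> [:\<kappa>:]" for \<kappa>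
  proof
    assume "?x ^ n = [:\<kappa>:]"
    then have "poly (?x ^ n) 0 = \<kappa>" "poly (?x ^ n) 1 = \<kappa>" by simp_all
    then show False using n by (simp add: zero_power)
  qed
  then have "[:?b ^ n:] - ?x ^ n \<noteq> 0" "?x ^ n - [:?a ^ n:] \<noteq> 0"
    by (metis eq_iff_diff_eq_0)+
  ultimately have "?a * ?b * (?a ^ n - ?b ^ n) = 0"
    unfolding smult_eq_0_iff mult_eq_0_iff by auto
  moreover have "h $ 1 ^ n = (- h $ 2) ^ n" if "(h $ 2) ^ n = (- h $ 1) ^ n"
  proof -
    have "(- h $ 2) ^ n = (-1) ^ n * (- h $ 1) ^ n"
      using that by (metis mult_minus1 power_mult_distrib)
    also have "\<dots> = (h $ 1) ^ n" by (simp flip: power_mult_distrib)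
    finally show ?thesis by simp
  qed
  ultimately show ?thesis using True by (auto simp: dual_vec_def on_side_def)
next
  case False
  \<comment> \<open>Now the line is the graph \<open>z = \<alpha> x + \<beta> y\<close>.\<close>
  define \<alpha> \<beta> where "\<alpha> = - h $ 1 / h $ 3" and "\<beta> = - h $ 2 / h $ 3"
  have h12: "h $ 1 = - \<alpha> * h $ 3" "h $ 2 = - \<beta> * h $ 3"
    using False by (simp_all add: \<alpha>_def \<beta>_def)
  have "s * (\<alpha> * s + \<beta>) * (s ^ n - 1) * (1 - (\<alpha> * s + \<beta>) ^ n) * ((\<alpha> * s + \<beta>) ^ n - s ^ n) = 0" for s
    using line[of s 1 "\<alpha> * s + \<beta>"] by (simp add: h12 algebra_simps)
  then have "\<alpha> = 0 \<and> \<beta> = 0 \<or> \<alpha> = 0 \<and> \<beta> ^ n = 1 \<or> \<beta> = 0 \<and> \<alpha> ^ n = 1"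
    by (rule affine_line_in_arrangement[OF n])
  moreover have "(h $ 2) ^ n = (- h $ 3) ^ n" if "\<beta> ^ n = 1"
  proof -
    have "h $ 2 = \<beta> * - h $ 3" using h12 by simp
    then show ?thesis using that by (metis mult_1 power_mult_distrib)
  qed
  moreover have "(h $ 3) ^ n = (- h $ 1) ^ n" if "\<alpha> ^ n = 1"
  proof -
    have "- h $ 1 = \<alpha> * h $ 3" using h12 by simp
    then show ?thesis using that by (metis mult_1 power_mult_distrib)
  qed
  ultimately show ?thesis using h12 by (auto simp: dual_vec_def on_side_def)
qed

lemma abs_mem_full_monomial_dual:
  assumes m: "m > 2" and h: "h \<noteq> 0"
  shows "abs_proj_plane h \<in> full_monomial_dual m \<longleftrightarrow> dual_vec (m - 2) h"
proof
  assume "abs_proj_plane h \<in> full_monomial_dual m"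
  then have *: "eval3 (full_monomial_poly m) r = 0"
    if "h $ 1 * r $ 1 + h $ 2 * r $ 2 + h $ 3 * r $ 3 = 0" for r
    using that abs_mem_full_monomial_dual_iff[OF h] by blast
  show "dual_vec (m - 2) h"
  proof (rule dual_vec_if_line_in_arrangement)
    show "m - 2 > 0" using m by simp
    fix x y z assume "h $ 1 * x + h $ 2 * y + h $ 3 * z = 0"
    then show "x * y * z * (x ^ (m - 2) - y ^ (m - 2)) * (y ^ (m - 2) - z ^ (m - 2))
        * (z ^ (m - 2) - x ^ (m - 2)) = 0"
      using *[of "vector [x, y, z]"] by (simp add: eval3_full_monomial_poly vector_3)
  qed (rule h)
next
  assume dv: "dual_vec (m - 2) h"
  have nz: "h $ 1 \<noteq> 0 \<or> h $ 2 \<noteq> 0 \<or> h $ 3 \<noteq> 0"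
    using h by (auto simp: vec_eq_iff forall_3)
  show "abs_proj_plane h \<in> full_monomial_dual m"
    unfolding abs_mem_full_monomial_dual_iff[OF h]
  proof (intro allI impI)
    fix r :: "complex ^ 3" assume r: "h $ 1 * r $ 1 + h $ 2 * r $ 2 + h $ 3 * r $ 3 = 0"
    consider "on_side (m - 2) (h $ 1) (h $ 2) (h $ 3)" | "on_side (m - 2) (h $ 2) (h $ 3) (h $ 1)"
      | "on_side (m - 2) (h $ 3) (h $ 1) (h $ 2)" using dv by (auto simp: dual_vec_def)
    then show "eval3 (full_monomial_poly m) r = 0"
    proof cases
      case 1
      from on_sideD[OF this, of "r $ 1" "r $ 2" "r $ 3"] show ?thesis
        using r nz by (auto simp: eval3_full_monomial_poly)
    next
      case 2
      from on_sideD[OF this, of "r $ 2" "r $ 3" "r $ 1"] show ?thesis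
        using r nz by (auto simp: eval3_full_monomial_poly algebra_simps)
    next
      case 3
      from on_sideD[OF this, of "r $ 3" "r $ 1" "r $ 2"] show ?thesis
        using r nz by (auto simp: eval3_full_monomial_poly algebra_simps)
    qed
  qed
qed

text \<open>Replaces projective points by vectors, so that membership becomes a matter of plain
  evaluations.\<close>

lemma sections_full_monomial_dual:
  assumes "m > 2"
  shows "sections j (full_monomial_dual m) =
    {F. homogeneous j F \<and> (\<forall>h. h \<noteq> 0 \<longrightarrow> dual_vec (m - 2) h \<longrightarrow> eval3 F h = 0)}"
proof -
  have "(\<forall>p\<in>full_monomial_dual m. vanishes_at F p)
      \<longleftrightarrow> (\<forall>h. h \<noteq> 0 \<longrightarrow> dual_vec (m - 2) h \<longrightarrow> eval3 F h = 0)" if "homogeneous j F" for F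
    using abs_mem_full_monomial_dual[OF assms] vanishes_at_abs[OF that] proj_plane_cases
    by metis
  then show ?thesis by (auto simp: sections_def)
qed

lemma abs_eq_if_scaled:
  assumes "v \<noteq> 0" "w = c *s v" "c \<noteq> 0"
  shows "abs_proj_plane w = abs_proj_plane v"
  using homogeneous_coords_abs[OF assms(1), of w] assms by (auto simp: homogeneous_coords_def)

lemma on_side_cases:
  assumes "on_side n x y z" "x \<noteq> 0 \<or> y \<noteq> 0" "n > 0"
  obtains "y = 0" "z = 0" | "x = 0" "z = 0"
    | \<zeta> where "\<zeta> ^ n = 1" "x \<noteq> 0" "y = - (x * \<zeta>)" "z = 0"
proof -
  have "\<exists>\<zeta>. \<zeta> ^ n = 1 \<and> y = - (x * \<zeta>)" if "x \<noteq> 0" "x ^ n = (- y) ^ n"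
    using that assms(3)
    by (intro exI[of _ "- y / x"]) (simp only: power_divide, auto simp: zero_power)
  with assms that show ?thesis unfolding on_side_def by metis
qed

lemma finite_full_monomial_dual:
  assumes "m > 2"
  shows "finite (full_monomial_dual m)"
proof -
  define U where "U = {\<zeta>::complex. \<zeta> ^ (m - 2) = 1}"
  \<comment> \<open>Representatives of the dual points: the three vertices and, on each side, one
    point per root of unity of order dividing \<open>m - 2\<close>.\<close>
  define W :: "(complex ^ 3) set" where
    "W = {vector [1, 0, 0], vector [0, 1, 0], vector [0, 0, 1]} \<union> (\<lambda>\<zeta>. vector [1, - \<zeta>, 0]) ` U
      \<union> (\<lambda>\<zeta>. vector [0, 1, - \<zeta>]) ` U \<union> (\<lambda>\<zeta>. vector [- \<zeta>, 0, 1]) ` U"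
  have "finite U" unfolding U_def using assms by (intro finite_roots_unity) simp
  then have "finite W" by (simp add: W_def)
  moreover have "p \<in> abs_proj_plane ` W" if "p \<in> full_monomial_dual m" for p
  proof -
    obtain h where h: "h \<noteq> 0" "p = abs_proj_plane h" by (rule proj_plane_cases)
    have nz: "h $ 1 \<noteq> 0 \<or> h $ 2 \<noteq> 0 \<or> h $ 3 \<noteq> 0"
      using h by (auto simp: vec_eq_iff forall_3)
    have dv: "dual_vec (m - 2) h" using that h abs_mem_full_monomial_dual[OF assms] by simp
    have W: "\<exists>w\<in>W. \<exists>c. c \<noteq> 0 \<and> h = c *s w" if "w \<in> W" "c \<noteq> 0" "h = c *s w" for w c
      using that by blast
    consider "on_side (m - 2) (h $ 1) (h $ 2) (h $ 3)" | "on_side (m - 2) (h $ 2) (h $ 3) (h $ 1)"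
      | "on_side (m - 2) (h $ 3) (h $ 1) (h $ 2)" using dv by (auto simp: dual_vec_def)
    then have "\<exists>w\<in>W. \<exists>c. c \<noteq> 0 \<and> h = c *s w"
    proof cases
      case 1
      moreover have "h $ 1 \<noteq> 0 \<or> h $ 2 \<noteq> 0" using 1 nz by (auto simp: on_side_def)
      ultimately show ?thesis
      proof (rule on_side_cases)
        show "m - 2 > 0" using assms by simp
      next
        assume "h $ 2 = 0" "h $ 3 = 0"
        then show ?thesis using nz
          by (intro W[of "vector [1, 0, 0]" "h $ 1"]) (auto simp: W_def vec_eq_iff forall_3 vector_3)
      next
        assume "h $ 1 = 0" "h $ 3 = 0"
        then show ?thesis using nz
          by (intro W[of "vector [0, 1, 0]" "h $ 2"]) (auto simp: W_def vec_eq_iff forall_3 vector_3)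
      next
        fix \<zeta> assume "\<zeta> ^ (m - 2) = 1" "h $ 1 \<noteq> 0" "h $ 2 = - (h $ 1 * \<zeta>)" "h $ 3 = 0"
        then show ?thesis
          by (intro W[of "vector [1, - \<zeta>, 0]" "h $ 1"])
             (auto simp: W_def U_def vec_eq_iff forall_3 vector_3)
      qed
    next
      case 2
      moreover have "h $ 2 \<noteq> 0 \<or> h $ 3 \<noteq> 0" using 2 nz by (auto simp: on_side_def)
      ultimately show ?thesis
      proof (rule on_side_cases)
        show "m - 2 > 0" using assms by simp
      next
        assume "h $ 3 = 0" "h $ 1 = 0"
        then show ?thesis using nz
          by (intro W[of "vector [0, 1, 0]" "h $ 2"]) (auto simp: W_def vec_eq_iff forall_3 vector_3)
      next
        assume "h $ 2 = 0" "h $ 1 = 0"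
        then show ?thesis using nz
          by (intro W[of "vector [0, 0, 1]" "h $ 3"]) (auto simp: W_def vec_eq_iff forall_3 vector_3)
      next
        fix \<zeta> assume "\<zeta> ^ (m - 2) = 1" "h $ 2 \<noteq> 0" "h $ 3 = - (h $ 2 * \<zeta>)" "h $ 1 = 0"
        then show ?thesis
          by (intro W[of "vector [0, 1, - \<zeta>]" "h $ 2"])
             (auto simp: W_def U_def vec_eq_iff forall_3 vector_3)
      qed
    next
      case 3
      moreover have "h $ 3 \<noteq> 0 \<or> h $ 1 \<noteq> 0" using 3 nz by (auto simp: on_side_def)
      ultimately show ?thesis
      proof (rule on_side_cases)
        show "m - 2 > 0" using assms by simp
      next
        assume "h $ 1 = 0" "h $ 2 = 0"
        then show ?thesis using nz
          by (intro W[of "vector [0, 0, 1]" "h $ 3"]) (auto simp: W_def vec_eq_iff forall_3 vector_3)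
      next
        assume "h $ 3 = 0" "h $ 2 = 0"
        then show ?thesis using nz
          by (intro W[of "vector [1, 0, 0]" "h $ 1"]) (auto simp: W_def vec_eq_iff forall_3 vector_3)
      next
        fix \<zeta> assume "\<zeta> ^ (m - 2) = 1" "h $ 3 \<noteq> 0" "h $ 1 = - (h $ 3 * \<zeta>)" "h $ 2 = 0"
        then show ?thesis
          by (intro W[of "vector [- \<zeta>, 0, 1]" "h $ 3"])
             (auto simp: W_def U_def vec_eq_iff forall_3 vector_3)
      qed
    qed
    then obtain w c where "w \<in> W" "c \<noteq> 0" "h = c *s w" by blast
    moreover from this have "w \<noteq> 0" using h by auto
    ultimately show ?thesis using abs_eq_if_scaled[of w h c] h by auto
  qed
  ultimately show ?thesis by (meson finite_imageI finite_subset subsetI)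
qed


section \<open>The unexpected curves\<close>

text \<open>The form \<open>E\<close> of the opening comment for \<open>q = v\<close>: the bases of
  the powers are the coordinates of the cross product of the variable point with
  \<open>v\<close>.\<close>

definition unexpected_form :: "nat \<Rightarrow> complex ^ 3 \<Rightarrow> poly3" where
  "unexpected_form n v =
     X * (scale3 (v $ 3) Y - scale3 (v $ 2) Z) ^ Suc n
     + Y * (scale3 (v $ 1) Z - scale3 (v $ 3) X) ^ Suc n
     + Z * (scale3 (v $ 2) X - scale3 (v $ 1) Y) ^ Suc n"

lemma homogeneous_unexpected_form: "homogeneous (n + 2) (unexpected_form n v)"
proof -
  have "homogeneous (1 + 1 * Suc n) (unexpected_form n v)"
    unfolding unexpected_form_def
    by (intro homogeneous_add homogeneous_mult homogeneous_power homogeneous_diff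
        homogeneous_scale3 homogeneous_vars)
  then show ?thesis by simp
qed

text \<open>For \<open>z = 0\<close> the sum is \<open>x * y * c\<close> times
  \<open>(c * y)^n - (- (c * x))^n\<close>, which is zero if \<open>x\<close>, \<open>y\<close> or
  \<open>x^n - (- y)^n\<close> is.\<close>

lemma on_side_unexpected:
  assumes "on_side n x y z"
  shows "x * (c * y - b * z) ^ Suc n + y * (a * z - c * x) ^ Suc n + z * (b * x - a * y) ^ Suc n = 0"
proof (cases "x = 0 \<or> y = 0")
  case True
  then show ?thesis using assms by (auto simp: on_side_def)
next
  case False
  then have z: "z = 0" and xy: "x ^ n = (- y) ^ n" using assms by (auto simp: on_side_def)
  have "(c * y) ^ n = (- c * - y) ^ n" "(- (c * x)) ^ n = (- c * x) ^ n" by simp_all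
  then have "(c * y) ^ n = (- (c * x)) ^ n" by (metis power_mult_distrib xy)
  then show ?thesis using z by (simp add: algebra_simps)
qed

lemma eval3_unexpected_form:
  "eval3 (unexpected_form n v) w =
     w $ 1 * (v $ 3 * w $ 2 - v $ 2 * w $ 3) ^ Suc n + w $ 2 * (v $ 1 * w $ 3 - v $ 3 * w $ 1) ^ Suc n
     + w $ 3 * (v $ 2 * w $ 1 - v $ 1 * w $ 2) ^ Suc n"
  by (simp add: unexpected_form_def del: power_Suc)

lemma unexpected_form_dual_vec:
  assumes "dual_vec n h"
  shows "eval3 (unexpected_form n v) h = 0"
  using assms unfolding dual_vec_def
proof (elim disjE)
  assume "on_side n (h $ 1) (h $ 2) (h $ 3)"
  from on_side_unexpected[OF this, of "v $ 3" "v $ 2" "v $ 1"] show ?thesis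
    by (simp only: eval3_unexpected_form)
next
  assume "on_side n (h $ 2) (h $ 3) (h $ 1)"
  from on_side_unexpected[OF this, of "v $ 1" "v $ 3" "v $ 2"] show ?thesis
    by (simp only: eval3_unexpected_form ac_simps)
next
  assume "on_side n (h $ 3) (h $ 1) (h $ 2)"
  from on_side_unexpected[OF this, of "v $ 2" "v $ 1" "v $ 3"] show ?thesis
    by (simp only: eval3_unexpected_form ac_simps)
qed

lemma unexpected_form_sections:
  assumes "m > 2"
  shows "unexpected_form (m - 2) v \<in> sections m (full_monomial_dual m)"
proof -
  have "m - 2 + 2 = m" using assms by simp
  then have "homogeneous m (unexpected_form (m - 2) v)"
    using homogeneous_unexpected_form[of "m - 2" v] by (simp only:)
  then show ?thesis
    by (simp add: sections_full_monomial_dual[OF assms] unexpected_form_dual_vec)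
qed

lemma unexpected_form_vanishes_to_order:
  assumes "v \<noteq> 0"
  shows "vanishes_to_order (Suc n) (unexpected_form n v) (abs_proj_plane v)"
  unfolding vanishes_to_order_def homogeneous_coords_abs[OF assms] unexpected_form_def foldr_partial_add
  by (auto simp: eval3_foldr_partial_power simp del: power_Suc)

lemma unexpected_form_sections_fat:
  assumes "m > 2" "v \<noteq> 0"
  shows "unexpected_form (m - 2) v \<in> sections_fat m (full_monomial_dual m) (m - 1) (abs_proj_plane v)"
proof -
  have "Suc (m - 2) = m - 1" using assms by simp
  then show ?thesis
    using unexpected_form_vanishes_to_order[OF assms(2), of "m - 2"] unexpected_form_sections[OF assms(1)]
    by (simp add: sections_fat_def)
qed

text \<open>The factors \<open>Y + \<zeta> X\<close> and those with \<open>n\<close>th powers keep \<open>P\<close> and \<open>Q\<close> free of common zeros; \<open>X + \<zeta> Y + Z\<close>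
  keeps the projections from \<open>q\<close> of the dual points used in \<open>sections_fat_subset_span\<close> distinct.\<close>

definition general_poly :: "nat \<Rightarrow> poly3" where
  "general_poly n = X * Y * Z * (Y ^ n - (- Z) ^ n) * (Z ^ n - (- X) ^ n)
     * (\<Prod>\<zeta>\<in>{\<zeta>. \<zeta> ^ n = 1}. (Y + scale3 \<zeta> X) * ((Y + scale3 \<zeta> X) ^ n - (- Z) ^ n)
          * (X + scale3 \<zeta> Y + Z))"

lemma homogeneous_general_poly: "\<exists>d. homogeneous d (general_poly n)"
proof (intro exI)
  let ?e = "\<lambda>\<zeta>::complex. (1 + 1 * n) + 1"
  show "homogeneous (1 + 1 + 1 + 1 * n + 1 * n + sum ?e {\<zeta>. \<zeta> ^ n = 1}) (general_poly n)"
    unfolding general_poly_def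
    by (intro homogeneous_mult homogeneous_prod homogeneous_diff homogeneous_power
        homogeneous_minus homogeneous_add homogeneous_scale3 homogeneous_vars)
qed

lemma general_poly_nonzero:
  assumes "n > 0"
  shows "general_poly n \<noteq> 0"
proof -
  have nz: "F \<noteq> 0" if "eval3 F v \<noteq> 0" for F v using that by auto
  have "Y ^ n - (- Z) ^ n \<noteq> 0" "Z ^ n - (- X) ^ n \<noteq> 0"
    using nz[of "Y ^ n - (- Z) ^ n" "vector [0, 1, 0]"] nz[of "Z ^ n - (- X) ^ n" "vector [0, 0, 1]"]
      assms by (simp_all add: vector_3 zero_power)
  moreover have "Y + scale3 \<zeta> X \<noteq> 0" "(Y + scale3 \<zeta> X) ^ n - (- Z) ^ n \<noteq> 0"
    "X + scale3 \<zeta> Y + Z \<noteq> 0" for \<zeta>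
    using nz[of "Y + scale3 \<zeta> X" "vector [0, 1, 0]"]
      nz[of "(Y + scale3 \<zeta> X) ^ n - (- Z) ^ n" "vector [0, 1, 0]"]
      nz[of "X + scale3 \<zeta> Y + Z" "vector [1, 0, 0]"] assms
    by (simp_all add: vector_3 zero_power)
  moreover have "X \<noteq> 0" "Y \<noteq> 0" "Z \<noteq> 0" by (simp_all add: X_def Y_def Z_def)
  moreover have "finite {\<zeta>::complex. \<zeta> ^ n = 1}" using assms by (intro finite_roots_unity) simp
  ultimately show ?thesis by (simp add: general_poly_def prod_zero_iff)
qed

lemma general_polyD:
  assumes "eval3 (general_poly n) v \<noteq> 0" "n > 0"
  shows "v $ 1 \<noteq> 0" "v $ 2 \<noteq> 0" "v $ 3 \<noteq> 0" "(v $ 2) ^ n \<noteq> (- v $ 3) ^ n"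
    "(v $ 3) ^ n \<noteq> (- v $ 1) ^ n"
    "\<zeta> ^ n = 1 \<Longrightarrow> v $ 2 + \<zeta> * v $ 1 \<noteq> 0"
    "\<zeta> ^ n = 1 \<Longrightarrow> (v $ 2 + \<zeta> * v $ 1) ^ n \<noteq> (- v $ 3) ^ n"
    "\<zeta> ^ n = 1 \<Longrightarrow> v $ 1 + \<zeta> * v $ 2 + v $ 3 \<noteq> 0"
proof -
  have "finite {\<zeta>::complex. \<zeta> ^ n = 1}" using assms by (intro finite_roots_unity) simp
  then show "v $ 1 \<noteq> 0" "v $ 2 \<noteq> 0" "v $ 3 \<noteq> 0" "(v $ 2) ^ n \<noteq> (- v $ 3) ^ n"
    "(v $ 3) ^ n \<noteq> (- v $ 1) ^ n"
    "\<zeta> ^ n = 1 \<Longrightarrow> v $ 2 + \<zeta> * v $ 1 \<noteq> 0"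
    "\<zeta> ^ n = 1 \<Longrightarrow> (v $ 2 + \<zeta> * v $ 1) ^ n \<noteq> (- v $ 3) ^ n"
    "\<zeta> ^ n = 1 \<Longrightarrow> v $ 1 + \<zeta> * v $ 2 + v $ 3 \<noteq> 0"
    using assms by (auto simp: general_poly_def prod_zero_iff)
qed

lemma generically_if_general:
  assumes "n > 0" "\<And>v. v \<noteq> 0 \<Longrightarrow> eval3 (general_poly n) v \<noteq> 0 \<Longrightarrow> P (abs_proj_plane v)"
  shows "generically P"
  unfolding generically_iff
  using homogeneous_general_poly[of n] general_poly_nonzero[OF assms(1)] assms(2) by blast

text \<open>\<open>P\<close> and \<open>Q\<close> say that \<open>E\<close> and its derivative along
  \<open>v = (a, b, c)\<close> vanish at \<open>(x, y, 0)\<close>. \<open>P\<close> leaves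
  \<open>x = 0\<close>, \<open>y = 0\<close> or \<open>y = - \<zeta> x\<close> with
  \<open>\<zeta>^n = 1\<close>; in each case \<open>Q\<close> becomes a product whose other factors
  are excluded by \<open>gen\<close>.\<close>

lemma no_common_zero:
  fixes a b c x y :: complex
  assumes gen: "a \<noteq> 0" "b \<noteq> 0" "c \<noteq> 0" "b ^ n \<noteq> (- c) ^ n" "c ^ n \<noteq> (- a) ^ n"
      "\<And>\<zeta>. \<zeta> ^ n = 1 \<Longrightarrow> b + \<zeta> * a \<noteq> 0" "\<And>\<zeta>. \<zeta> ^ n = 1 \<Longrightarrow> (b + \<zeta> * a) ^ n \<noteq> (- c) ^ n"
    and P: "x * (c * y) ^ Suc n + y * (- (c * x)) ^ Suc n = 0"
    and Q: "a * (c * y) ^ Suc n + b * (- (c * x)) ^ Suc n + c * (b * x - a * y) ^ Suc n = 0"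
  shows "x = 0 \<and> y = 0"
proof -
  have neg: "(- (s * t)) ^ k = (- s) ^ k * t ^ k" for s t :: complex and k
    by (metis mult_minus_left power_mult_distrib)
  show ?thesis
  proof (cases "y = 0")
    case True
    have "b * (- (c * x)) ^ Suc n + c * (b * x) ^ Suc n = x ^ Suc n * b * c * (b ^ n - (- c) ^ n)"
      by (simp only: neg power_mult_distrib) (simp add: algebra_simps)
    then show ?thesis using Q True gen by auto
  next
    case y: False
    have "x \<noteq> 0"
    proof
      assume "x = 0"
      have "a * (c * y) ^ Suc n + c * (- (a * y)) ^ Suc n = y ^ Suc n * a * c * (c ^ n - (- a) ^ n)"
        by (simp only: neg power_mult_distrib) (simp add: algebra_simps)
      then show False using Q \<open>x = 0\<close> y gen by simp
    qed
    define \<zeta> where "\<zeta> = - y / x"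
    have y_eq: "y = - (\<zeta> * x)" using \<open>x \<noteq> 0\<close> by (simp add: \<zeta>_def)
    have "x * (c * y) ^ Suc n + y * (- (c * x)) ^ Suc n = x * y * c * ((c * y) ^ n - (- (c * x)) ^ n)"
      by (simp add: algebra_simps)
    with P y \<open>x \<noteq> 0\<close> gen have eq: "(c * y) ^ n = (- (c * x)) ^ n" by simp
    moreover have "c * y = \<zeta> * - (c * x)" by (simp add: y_eq)
    ultimately have "\<zeta> ^ n * (- (c * x)) ^ n = (- (c * x)) ^ n"
      by (metis power_mult_distrib)
    then have \<zeta>: "\<zeta> ^ n = 1" using \<open>x \<noteq> 0\<close> gen by simp
    have bx: "b * x - a * y = (b + \<zeta> * a) * x" by (simp add: y_eq algebra_simps)
    have "a * (c * y) ^ Suc n + b * (- (c * x)) ^ Suc n + c * (b * x - a * y) ^ Suc n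
        = c * (b * x - a * y) * ((b * x - a * y) ^ n - (- (c * x)) ^ n)"
      by (simp only: power_Suc eq) (simp add: algebra_simps)
    also have "\<dots> = c * (b + \<zeta> * a) * x * x ^ n * ((b + \<zeta> * a) ^ n - (- c) ^ n)"
      unfolding bx by (simp only: neg power_mult_distrib) (simp add: algebra_simps)
    finally show ?thesis using Q gen \<zeta> \<open>x \<noteq> 0\<close> by auto
  qed
qed

lemma irreducible_unexpected_form:
  assumes n: "n > 0" and gen: "eval3 (general_poly n) v \<noteq> 0"
  shows "irreducible (unexpected_form n v)"
proof (rule irreducible_if_affine_in_direction)
  note gen' = general_polyD[OF gen n]
  \<comment> \<open>The cross product with \<open>v\<close> does not change when a multiple of
    \<open>v\<close> is added, so only the outer factors of \<open>E\<close> move; \<open>?G\<close>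
    has the coordinates of \<open>v\<close> in their place.\<close>
  let ?G = "scale3 (v $ 1) ((scale3 (v $ 3) Y - scale3 (v $ 2) Z) ^ Suc n)
     + scale3 (v $ 2) ((scale3 (v $ 1) Z - scale3 (v $ 3) X) ^ Suc n)
     + scale3 (v $ 3) ((scale3 (v $ 2) X - scale3 (v $ 1) Y) ^ Suc n)"
  show "v $ 3 \<noteq> 0" by (rule gen')
  show "eval3 (unexpected_form n v) 0 = 0" by (simp add: eval3_unexpected_form)
  show "eval3 (unexpected_form n v) (w + s *s v) = eval3 (unexpected_form n v) w + s * eval3 ?G w"
    for w s
  proof -
    have "v $ i * (w + s *s v) $ j - v $ j * (w + s *s v) $ i = v $ i * w $ j - v $ j * w $ i" for i j
      by (simp add: algebra_simps)
    then show ?thesis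
      by (simp add: eval3_unexpected_form algebra_simps del: power_Suc)
  qed
  fix x y
  assume "eval3 (unexpected_form n v) (vector [x, y, 0]) = 0" "eval3 ?G (vector [x, y, 0]) = 0"
  then show "x = 0 \<and> y = 0"
    by (intro no_common_zero[of "v $ 1" "v $ 2" "v $ 3" n])
       (simp_all add: gen' eval3_unexpected_form vector_3 del: power_Suc)
qed

section \<open>Vanishing on the sides of the triangle, and uniqueness\<close>

lemma minus_2_power_neq_1:
  assumes "n > 0"
  shows "(- 2 :: complex) ^ n \<noteq> 1"
proof
  assume "(- 2 :: complex) ^ n = 1"
  then have "norm ((- 2 :: complex) ^ n) = 1" by simp
  then show False using one_less_power[of "2::real" n] assms by (simp add: norm_power)
qed

text \<open>The points \<open>u\<close>, \<open>v\<close> and \<open>u - \<zeta> v\<close> are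
  \<open>n + 2\<close> zeros on the side, with \<open>v\<close> at infinity. This settles
  \<open>d \<le> Suc n\<close>; in degree \<open>n + 2\<close> the test point \<open>u + 2 v\<close>
  supplies one more.\<close>

lemma vanishes_on_side:
  assumes n: "n > 0" and hom: "homogeneous d F" and u: "eval3 F u = 0" and v: "eval3 F v = 0"
    and roots: "\<And>\<zeta>. \<zeta> ^ n = 1 \<Longrightarrow> eval3 F (u + (- \<zeta>) *s v) = 0"
    and d: "d \<le> Suc n \<or> d \<le> n + 2 \<and> eval3 F (u + 2 *s v) = 0"
  shows "eval3 F (s *s u + t *s v) = 0"
proof -
  define S where "S = insert 0 (uminus ` {\<zeta>::complex. \<zeta> ^ n = 1})"
  have fin: "finite {\<zeta>::complex. \<zeta> ^ n = 1}" using n by (intro finite_roots_unity) simp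
  then have S: "finite S" "card S = Suc n"
    using n card_roots_unity_eq[OF n] by (auto simp: S_def card_insert_if card_image zero_power)
  have zero: "eval3 F (u + t *s v) = 0" if "t \<in> S" for t
    using that u roots by (auto simp: S_def)
  show ?thesis
  proof (cases "d \<le> Suc n")
    case True
    then show ?thesis using S zero v by (intro vanishes_on_line[OF hom, of S]) auto
  next
    case False
    \<comment> \<open>The test point is new, because \<open>- 2\<close> is not a root of
      unity.\<close>
    have "2 \<notin> S" using minus_2_power_neq_1[OF n] by (auto simp: S_def)
    then show ?thesis using S zero v False d
      by (intro vanishes_on_line[OF hom, of "insert 2 S"]) auto
  qed
qed

lemma sections_vanish_on_sides:
  assumes m: "m > 2" and F: "F \<in> sections d (full_monomial_dual m)"
  shows "d < m \<or> d = m \<and> eval3 F (vector [1, 2, 0]) = 0 \<Longrightarrow> eval3 F (vector [x, y, 0]) = 0"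
    "d < m \<or> d = m \<and> eval3 F (vector [0, 1, 2]) = 0 \<Longrightarrow> eval3 F (vector [0, x, y]) = 0"
    "d < m \<or> d = m \<and> eval3 F (vector [2, 0, 1]) = 0 \<Longrightarrow> eval3 F (vector [y, 0, x]) = 0"
proof -
  have n: "m - 2 > 0" using m by simp
  have hom: "homogeneous d F" and zero: "\<And>h. h \<noteq> 0 \<Longrightarrow> dual_vec (m - 2) h \<Longrightarrow> eval3 F h = 0"
    using F by (auto simp: sections_full_monomial_dual[OF m])
  let ?e1 = "vector [1, 0, 0] :: complex ^ 3"
  let ?e2 = "vector [0, 1, 0] :: complex ^ 3"
  let ?e3 = "vector [0, 0, 1] :: complex ^ 3"
  have e: "eval3 F ?e1 = 0" "eval3 F ?e2 = 0" "eval3 F ?e3 = 0"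
    by (rule zero; simp add: vec_eq_iff forall_3 vector_3 dual_vec_def on_side_def)+
  have roots: "eval3 F (?e1 + (- \<zeta>) *s ?e2) = 0" "eval3 F (?e2 + (- \<zeta>) *s ?e3) = 0"
    "eval3 F (?e3 + (- \<zeta>) *s ?e1) = 0" if "\<zeta> ^ (m - 2) = 1" for \<zeta>
    by (rule zero; use that in \<open>simp add: vec_eq_iff forall_3 vector_3 dual_vec_def on_side_def\<close>)+
  have 1: "x *s ?e1 + y *s ?e2 = vector [x, y, 0]" "x *s ?e2 + y *s ?e3 = vector [0, x, y]"
    "x *s ?e3 + y *s ?e1 = vector [y, 0, x]" for x y
    by (simp_all add: vec_eq_iff forall_3 vector_3)
  have 2: "?e1 + 2 *s ?e2 = vector [1, 2, 0]" "?e2 + 2 *s ?e3 = vector [0, 1, 2]"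
    "?e3 + 2 *s ?e1 = vector [2, 0, 1]"
    by (simp_all add: vec_eq_iff forall_3 vector_3)
  have d: "d < m \<or> d = m \<and> P \<Longrightarrow> d \<le> Suc (m - 2) \<or> d \<le> (m - 2) + 2 \<and> P" for P using m by auto
  show "eval3 F (vector [x, y, 0]) = 0" if "d < m \<or> d = m \<and> eval3 F (vector [1, 2, 0]) = 0"
    using vanishes_on_side[OF n hom e(1,2) roots(1), of x y] d[OF that] unfolding 1 2 by blast
  show "eval3 F (vector [0, x, y]) = 0" if "d < m \<or> d = m \<and> eval3 F (vector [0, 1, 2]) = 0"
    using vanishes_on_side[OF n hom e(2,3) roots(2), of x y] d[OF that] unfolding 1 2 by blast
  show "eval3 F (vector [y, 0, x]) = 0" if "d < m \<or> d = m \<and> eval3 F (vector [2, 0, 1]) = 0"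
    using vanishes_on_side[OF n hom e(3,1) roots(3), of x y] d[OF that] unfolding 1 2 by blast
qed

lemma sections_fat_affine:
  assumes F: "F \<in> sections_fat j A (j - 1) (abs_proj_plane v)" and "v \<noteq> 0" "j \<ge> 2"
  shows "eval3 F (w + s *s v) = eval3 F w + s * eval3 (dir_deriv v F) w"
proof (rule affine_in_direction)
  show "homogeneous j F" using F by (simp add: sections_fat_def sections_def)
  have "homogeneous_coords (abs_proj_plane v) v"
    using \<open>v \<noteq> 0\<close> by (simp add: homogeneous_coords_def)
  then show "eval3 (foldr partial is F) v = 0" if "length is < j - 1" for "is"
    using F that by (auto simp: sections_fat_def vanishes_to_order_def)
qed fact

text \<open>The line through \<open>w\<close> in direction \<open>v\<close> meets
  \<open>z = 0\<close> and \<open>x = 0\<close>, where \<open>F\<close> vanishes since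
  \<open>j < m\<close>. As \<open>F\<close> is affine on it, this gives
  \<open>v $ 3 * F = w $ 3 * G\<close> and \<open>v $ 1 * F = w $ 1 * G\<close> at \<open>w\<close>.
  Eliminating \<open>G\<close> yields \<open>H * F = 0\<close> with \<open>H\<close>
  nonzero.\<close>

lemma sections_fat_low_degree:
  assumes m: "m > 2" and j: "j \<ge> 2" "j < m" and v: "v $ 1 \<noteq> 0" "v $ 3 \<noteq> 0"
    and F: "F \<in> sections_fat j (full_monomial_dual m) (j - 1) (abs_proj_plane v)"
  shows "F = 0"
proof -
  have F': "F \<in> sections j (full_monomial_dual m)" using F by (simp add: sections_fat_def)
  have "v \<noteq> 0" using v by auto
  note aff = sections_fat_affine[OF F this j(1)]
  let ?G = "dir_deriv v F" and ?H = "scale3 (v $ 1) Z - scale3 (v $ 3) X"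
  have "?H * F = 0"
  proof (rule eval3_eq_0)
    fix w :: "complex ^ 3"
    let ?s = "- w $ 3 / v $ 3" and ?t = "- w $ 1 / v $ 1"
    have "w + ?s *s v = vector [(w + ?s *s v) $ 1, (w + ?s *s v) $ 2, 0]"
      "w + ?t *s v = vector [0, (w + ?t *s v) $ 2, (w + ?t *s v) $ 3]"
      using v by (simp_all add: vec_eq_iff forall_3 vector_3)
    then have "eval3 F (w + ?s *s v) = 0" "eval3 F (w + ?t *s v) = 0"
      using sections_vanish_on_sides[OF m F'] j by metis+
    then have F_s: "eval3 F w = - ?s * eval3 ?G w" and F_t: "eval3 F w = - ?t * eval3 ?G w"
      unfolding aff by (simp_all add: eq_neg_iff_add_eq_0)
    have "v $ 3 * eval3 F w = w $ 3 * eval3 ?G w"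
      unfolding F_s using v by simp
    moreover have "v $ 1 * eval3 F w = w $ 1 * eval3 ?G w"
      unfolding F_t using v by simp
    ultimately have "v $ 1 * w $ 3 * eval3 F w = v $ 3 * w $ 1 * eval3 F w" by algebra
    then show "eval3 (?H * F) w = 0" by (simp add: left_diff_distrib)
  qed
  moreover have "eval3 ?H (vector [1, 0, 0]) \<noteq> 0" using v by (simp add: vector_3)
  then have "?H \<noteq> 0" by (metis eval3_simps(1))
  ultimately show ?thesis by (metis mult_eq_0_iff)
qed

lemma sections_fat_subset_span:
  assumes m: "m > 2" and gen: "eval3 (general_poly (m - 2)) v \<noteq> 0"
    and F: "F \<in> sections_fat m (full_monomial_dual m) (m - 1) (abs_proj_plane v)"
  shows "\<exists>\<kappa>. F = scale3 \<kappa> (unexpected_form (m - 2) v)"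
proof -
  define n where "n = m - 2"
  have n: "n > 0" "m = n + 2" using m by (simp_all add: n_def)
  note gen' = general_polyD[OF gen[folded n_def] n(1)]
  have v: "v \<noteq> 0" using gen'(1) by auto
  let ?E = "unexpected_form n v"
  have "eval3 ?E (vector [1, 2, 0]) = (v $ 3) ^ Suc n * 2 * (2 ^ n - (- 1) ^ n)"
    by (simp add: eval3_unexpected_form vector_3 power_mult_distrib power_minus[of "v $ 3"] algebra_simps)
  moreover have "(2::complex) ^ n \<noteq> (- 1) ^ n"
  proof
    assume "(2::complex) ^ n = (- 1) ^ n"
    then have "norm ((2::complex) ^ n) = norm ((- 1 :: complex) ^ n)" by simp
    then show False using one_less_power[of "2::real" n] n by (simp add: norm_power)
  qed
  ultimately have E: "eval3 ?E (vector [1, 2, 0]) \<noteq> 0" using gen'(3) by simp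
  \<comment> \<open>This choice adds the zero \<open>(1 : 2 : 0)\<close> to the \<open>m\<close>
    dual points on \<open>z = 0\<close>, which is enough for degree \<open>m\<close>.\<close>
  define \<kappa> where "\<kappa> = eval3 F (vector [1, 2, 0]) / eval3 ?E (vector [1, 2, 0])"
  define F' where "F' = F - scale3 \<kappa> ?E"
  note E_fat = unexpected_form_sections_fat[OF m v, folded n_def]
  have F': "F' \<in> sections m (full_monomial_dual m)"
    using F E_fat
    by (auto simp: F'_def sections_fat_def sections_full_monomial_dual[OF m]
        intro!: homogeneous_diff homogeneous_scale3)
  then have hom: "homogeneous m F'" by (simp add: sections_def)
  have plane: "eval3 F' (vector [x, y, 0]) = 0" for x y
    using E by (intro sections_vanish_on_sides[OF m F']) (simp add: F'_def \<kappa>_def)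
  define G where "G = dir_deriv v F'"
  have G: "homogeneous (Suc n) G"
    unfolding G_def using homogeneous_dir_deriv[OF hom] n by simp
  have aff: "eval3 F' (w + s *s v) = eval3 F' w + s * eval3 G w" for w s
  proof -
    have "m \<ge> 2" using m by simp
    have G_eq: "eval3 G w = eval3 (dir_deriv v F) w - \<kappa> * eval3 (dir_deriv v ?E) w"
      by (simp add: F'_def G_def dir_deriv_def algebra_simps)
    show ?thesis
      unfolding G_eq
      using sections_fat_affine[OF F v \<open>m \<ge> 2\<close>, of w s] sections_fat_affine[OF E_fat v \<open>m \<ge> 2\<close>, of w s]
      by (simp add: F'_def algebra_simps)
  qed
  \<comment> \<open>Project \<open>w\<close> from \<open>v\<close> to the plane
    \<open>z = 0\<close>: there \<open>F'\<close> vanishes, and only the linear term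
    remains.\<close>
  have F'_eq: "eval3 F' w = w $ 3 / v $ 3 * eval3 G (vector [w $ 1 - w $ 3 / v $ 3 * v $ 1,
      w $ 2 - w $ 3 / v $ 3 * v $ 2, 0])" for w
    by (subst plane_decomposition[OF gen'(3), of w]) (simp only: aff plane add_0)
  \<comment> \<open>The projection of \<open>h\<close> from \<open>v\<close> is
    \<open>(x : y : 0)\<close>, with affine coordinate \<open>x / y\<close>.\<close>
  have zero: "eval3 G (vector [0, 1, 0] + (x / y) *s vector [1, 0, 0]) = 0"
    if "dual_vec n h" "h $ 3 \<noteq> 0" "x = v $ 3 * h $ 1 - h $ 3 * v $ 1"
      "y = v $ 3 * h $ 2 - h $ 3 * v $ 2" "y \<noteq> 0" for h x y
  proof -
    have "h \<noteq> 0" using that by auto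
    then have "eval3 F' h = 0" using F' that
      by (auto simp: sections_full_monomial_dual[OF m] n_def)
    then have "eval3 G (vector [h $ 1 - h $ 3 / v $ 3 * v $ 1, h $ 2 - h $ 3 / v $ 3 * v $ 2, 0]) = 0"
      using that gen'(3) F'_eq[of h] by simp
    moreover have "h $ 1 - h $ 3 / v $ 3 * v $ 1 = x / v $ 3" "h $ 2 - h $ 3 / v $ 3 * v $ 2 = y / v $ 3"
      using gen'(3) by (simp_all add: that(3,4) diff_divide_distrib)
    moreover have "vector [x / v $ 3, y / v $ 3, 0]
        = (y / v $ 3) *s (vector [0, 1, 0] + (x / y) *s vector [1, 0, 0] :: complex ^ 3)"
      using \<open>y \<noteq> 0\<close> gen'(3) by (simp add: vec_eq_iff forall_3 vector_3)
    ultimately show ?thesis using eval3_homogeneous[OF G] \<open>y \<noteq> 0\<close> gen'(3) by simp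
  qed
  define a b c where "a = v $ 1" and "b = v $ 2" and "c = v $ 3"
  have abc: "a \<noteq> 0" "b \<noteq> 0" "c \<noteq> 0" using gen' by (simp_all add: a_def b_def c_def)
  have sum: "a + \<zeta> * b + c \<noteq> 0" if "\<zeta> ^ n = 1" for \<zeta>
    using gen'(8)[OF that] by (simp add: a_def b_def c_def)
  \<comment> \<open>These are the values of \<open>y\<close> in \<open>zero\<close> for the dual
    points \<open>(0 : 1 : - \<zeta>)\<close>.\<close>
  have cb: "c + b * \<zeta> \<noteq> 0" if "\<zeta> ^ n = 1" for \<zeta>
  proof
    assume "c + b * \<zeta> = 0"
    then have "b * \<zeta> = - c" by (metis add.commute eq_neg_iff_add_eq_0)
    then have "b ^ n = (- c) ^ n" using that by (metis mult.right_neutral power_mult_distrib)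
    then show False using gen'(4) by (simp add: b_def c_def)
  qed
  define U where "U = {\<zeta>::complex. \<zeta> ^ n = 1}"
  define r where "r = (\<lambda>\<zeta>. a * \<zeta> / (c + b * \<zeta>))"
  \<comment> \<open>The projections of \<open>(0 : 0 : 1)\<close>, \<open>(-1 : 0 : 1)\<close> and
    the \<open>n\<close> points \<open>(0 : 1 : - \<zeta>)\<close>: together \<open>n + 2\<close>,
    one more than the degree of \<open>G\<close>.\<close>
  define S where "S = insert (a / b) (insert ((c + a) / b) (r ` U))"
  have "finite U" unfolding U_def using n by (intro finite_roots_unity) simp
  have "inj_on r U"
  proof (rule inj_onI)
    fix \<zeta> \<xi> assume *: "\<zeta> \<in> U" "\<xi> \<in> U" "r \<zeta> = r \<xi>"
    then have "a * \<zeta> * (c + b * \<xi>) = a * \<xi> * (c + b * \<zeta>)"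
      using cb by (simp add: r_def U_def frac_eq_eq)
    then have "a * c * (\<zeta> - \<xi>) = 0" by (simp add: algebra_simps)
    then show "\<zeta> = \<xi>" using abc by simp
  qed
  moreover have "a / b \<notin> r ` U"
  proof
    assume "a / b \<in> r ` U"
    then obtain \<zeta> where "\<zeta> \<in> U" "a / b = r \<zeta>" by blast
    then have "a * (c + b * \<zeta>) = a * \<zeta> * b" using abc cb by (simp add: r_def U_def frac_eq_eq)
    then have "a * c = 0" by (simp add: algebra_simps)
    then show False using abc by simp
  qed
  \<comment> \<open>Equality would put \<open>v\<close> on the line joining
    \<open>(-1 : 0 : 1)\<close> to some \<open>(0 : 1 : - \<zeta>)\<close>, against
    \<open>sum\<close>.\<close>
  moreover have "(c + a) / b \<notin> r ` U"
  proof
    assume "(c + a) / b \<in> r ` U"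
    then obtain \<zeta> where \<zeta>: "\<zeta> \<in> U" "(c + a) / b = r \<zeta>" by blast
    then have "(c + a) * (c + b * \<zeta>) = a * \<zeta> * b" using abc cb by (simp add: r_def U_def frac_eq_eq)
    then have "c * (a + \<zeta> * b + c) = 0" by (simp add: algebra_simps)
    then show False using abc sum \<zeta> by (simp add: U_def)
  qed
  moreover have "a / b \<noteq> (c + a) / b" using abc by simp
  ultimately have S: "finite S" "card S = n + 2"
    using \<open>finite U\<close> card_roots_unity_eq[OF n(1)] by (simp_all add: S_def U_def card_image)
  have S_zero: "eval3 G (vector [0, 1, 0] + t *s vector [1, 0, 0]) = 0" if t: "t \<in> S" for t
  proof -
    consider "t = a / b" | "t = (c + a) / b" | \<zeta> where "\<zeta> ^ n = 1" "t = a * \<zeta> / (c + b * \<zeta>)"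
      using t unfolding S_def U_def r_def by blast
    then show ?thesis
    proof cases
      case 1
      then have "t = (- a) / (- b)" by simp
      then show ?thesis using abc
        by (simp only:) (rule zero[of "vector [0, 0, 1]"];
            simp add: vector_3 dual_vec_def on_side_def a_def b_def c_def)
    next
      case 2
      moreover have "- c - a = - (c + a)" by simp
      ultimately have "t = (- c - a) / (- b)" by (metis minus_divide_divide)
      then show ?thesis using abc
        by (simp only:) (rule zero[of "vector [- 1, 0, 1]"];
            simp add: vector_3 dual_vec_def on_side_def a_def b_def c_def)
    next
      case 3
      moreover have "\<zeta> \<noteq> 0" using 3(1) n(1) by (auto simp: zero_power)
      ultimately show ?thesis using abc cb[of \<zeta>]
        by (simp only:) (rule zero[of "vector [0, 1, - \<zeta>]"];
            simp add: vector_3 dual_vec_def on_side_def a_def b_def c_def; auto)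
    qed
  qed
  have G_plane: "eval3 G (vector [x, y, 0]) = 0" for x y
  proof -
    have "vector [x, y, 0] = y *s vector [0, 1, 0] + x *s (vector [1, 0, 0] :: complex ^ 3)"
      by (simp add: vec_eq_iff forall_3 vector_3)
    then show ?thesis using vanishes_on_line[OF G S(1) S_zero, of y x] S by simp
  qed
  then have "F' = 0" by (intro eval3_eq_0) (simp add: F'_eq)
  then show ?thesis by (auto simp: F'_def n_def)
qed


section \<open>Dimensions\<close>

text \<open>For two of the variables, this form cuts out exactly the dual points on the side where
  the third variable is zero, and vanishes on the other two sides.\<close>

definition side_form :: "nat \<Rightarrow> poly3 \<Rightarrow> poly3 \<Rightarrow> poly3" where
  "side_form n A B = A * B * (A ^ n - (- B) ^ n)"

lemma homogeneous_side_form: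
  assumes "homogeneous 1 A" "homogeneous 1 B"
  shows "homogeneous (n + 2) (side_form n A B)"
proof -
  have "homogeneous (1 + 1 + 1 * n) (side_form n A B)"
    unfolding side_form_def
    by (intro homogeneous_mult homogeneous_power homogeneous_diff homogeneous_minus assms)
  then show ?thesis by simp
qed

lemma side_form_sections:
  assumes m: "m > 2" and AB: "(A, B) \<in> {(X, Y), (Y, Z), (Z, X)}"
  shows "side_form (m - 2) A B \<in> sections m (full_monomial_dual m)"
proof -
  have "m - 2 + 2 = m" using m by simp
  moreover have "homogeneous 1 A" "homogeneous 1 B" using AB homogeneous_vars by auto
  ultimately have "homogeneous m (side_form (m - 2) A B)"
    using homogeneous_side_form by metis
  moreover have "eval3 (side_form (m - 2) A B) h = 0" if "dual_vec (m - 2) h" for h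
    using that AB unfolding dual_vec_def on_side_def by (auto simp: side_form_def)
  ultimately show ?thesis by (simp add: sections_full_monomial_dual[OF m])
qed

lemma poly_poly_eq_0:
  fixes p :: "complex poly poly"
  assumes "\<And>x y. poly (poly p [:y:]) x = 0"
  shows "p = 0"
proof -
  have "[:p:] = 0" by (rule eval3_eq_0) (simp add: eval3_def assms)
  then show ?thesis by simp
qed

text \<open>Setting a variable to zero leaves the part of \<open>F\<close> free of it. For the
  outermost variable this is \<open>coeff F 0\<close>; for the others it acts inside the nesting
  through \<open>map_poly\<close>.\<close>

lemma coeff3_eq_0_if_vanishes_on_sides:
  shows "(\<And>x y. eval3 F (vector [x, y, 0]) = 0) \<Longrightarrow> coeff3 F a b 0 = 0"
    "(\<And>x y. eval3 F (vector [0, x, y]) = 0) \<Longrightarrow> coeff3 F 0 b c = 0"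
    "(\<And>x y. eval3 F (vector [x, 0, y]) = 0) \<Longrightarrow> coeff3 F a 0 c = 0"
proof -
  assume "\<And>x y. eval3 F (vector [x, y, 0]) = 0"
  then have "coeff F 0 = 0" by (intro poly_poly_eq_0) (simp add: eval3_plane)
  then show "coeff3 F a b 0 = 0" by simp
next
  have inner: "poly (poly f [:y:]) 0 = poly (map_poly (\<lambda>f. coeff f 0) f) y" for f :: "complex poly poly" and y
    by (induction f) (simp_all add: map_poly_pCons poly_0_coeff_0)
  have outer: "poly (poly (poly F [:[:z:]:]) [:y:]) 0
      = poly (poly (map_poly (map_poly (\<lambda>f. coeff f 0)) F) [:z:]) y" for y z
    by (induction F) (simp_all add: map_poly_pCons inner)
  assume "\<And>x y. eval3 F (vector [0, x, y]) = 0"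
  then have "map_poly (map_poly (\<lambda>f. coeff f 0)) F = 0"
    by (intro poly_poly_eq_0) (simp add: eval3_def vector_3 flip: outer)
  then have "coeff (coeff (map_poly (map_poly (\<lambda>f. coeff f 0)) F) c) b = 0" by simp
  then show "coeff3 F 0 b c = 0" by (simp add: coeff_map_poly)
next
  have outer: "poly (poly F [:[:z:]:]) 0 = poly (map_poly (\<lambda>f. coeff f 0) F) [:z:]" for z
    by (induction F) (simp_all add: map_poly_pCons poly_0_coeff_0)
  assume "\<And>x y. eval3 F (vector [x, 0, y]) = 0"
  then have "map_poly (\<lambda>f. coeff f 0) F = 0"
    by (intro poly_poly_eq_0) (simp add: eval3_def vector_3 flip: outer)
  then have "coeff (map_poly (\<lambda>f. coeff f 0) F) c = 0" by simp
  then show "coeff3 F a 0 c = 0" by (simp add: coeff_map_poly)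
qed

lemma sum_less_eq_choose_2: "(\<Sum>i<k. i) = k choose 2"
  by (induction k) (simp_all add: numeral_2_eq_2)

text \<open>Counts the monomials of degree \<open>m\<close> divisible by \<open>X * Y * Z\<close>;
  the exponent of \<open>Z\<close> is \<open>m - a - b\<close>.\<close>

lemma card_interior_exponents: "card (SIGMA a:{1..<m}. {1..<m - a}) = (m - 1) choose 2"
proof -
  have "card (SIGMA a:{1..<m}. {1..<m - a}) = (\<Sum>a\<in>{1..<m}. m - a - 1)"
    by (simp add: card_SigmaI)
  also have "\<dots> = (\<Sum>i<m - 1. m - 1 - Suc i)"
    by (rule sum.reindex_bij_witness[of _ Suc "\<lambda>i. i - 1"]) auto
  also have "\<dots> = (\<Sum>i<m - 1. i)" by (rule sum.nat_diff_reindex)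
  finally show ?thesis by (simp add: sum_less_eq_choose_2)
qed

text \<open>Subtracting multiples of the three side forms makes a section vanish on all sides, which
  leaves only monomials divisible by \<open>X * Y * Z\<close>.\<close>

lemma dim_sections_le:
  assumes m: "m \<ge> 4"
  shows "poly3.dim (sections m (full_monomial_dual m)) \<le> m choose 2"
proof -
  have m2: "m > 2" using m by simp
  define n where "n = m - 2"
  have n: "n > 0" using m by (simp add: n_def)
  define T where "T = (SIGMA a:{1..<m}. {1..<m - a})"
  define mon where "mon = (\<lambda>(a, b). X ^ a * Y ^ b * Z ^ (m - a - b))"
  define W where "W = {side_form n X Y, side_form n Y Z, side_form n Z X} \<union> mon ` T"
  have "finite T" by (simp add: T_def)
  then have W: "finite W" by (simp add: W_def)
  have "card W \<le> card {side_form n X Y, side_form n Y Z, side_form n Z X} + card (mon ` T)"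
    unfolding W_def by (rule card_Un_le)
  also have "\<dots> \<le> 3 + card T"
    by (intro add_mono card_image_le \<open>finite T\<close>) (simp add: card_insert_if)
  also have "\<dots> = 3 + ((m - 1) choose 2)"
    by (simp only: T_def card_interior_exponents)
  \<comment> \<open>The two binomials differ by \<open>m - 1\<close>, which is at least 3 because
    \<open>m \<ge> 4\<close>.\<close>
  also have "\<dots> \<le> (m choose 2)"
    using m by (cases m) (auto simp: numeral_2_eq_2)
  finally have card: "card W \<le> m choose 2" .
  have "F \<in> poly3.span W" if F: "F \<in> sections m (full_monomial_dual m)" for F
  proof -
    \<comment> \<open>Each side form vanishes on the other two sides, so one test point per side
      fixes its coefficient independently.\<close>
    let ?k = "\<lambda>A B v. eval3 F v / eval3 (side_form n A B) v"
    define K where "K = scale3 (?k X Y (vector [1, 2, 0])) (side_form n X Y)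
       + scale3 (?k Y Z (vector [0, 1, 2])) (side_form n Y Z)
       + scale3 (?k Z X (vector [2, 0, 1])) (side_form n Z X)"
    define F' where "F' = F - K"
    have K: "K \<in> poly3.span W"
      unfolding K_def by (intro poly3.span_add poly3.span_scale poly3.span_base) (simp_all add: W_def)
    have F': "F' \<in> sections m (full_monomial_dual m)"
      using F side_form_sections[OF m2, folded n_def]
      unfolding F'_def K_def sections_full_monomial_dual[OF m2]
      by (auto intro!: homogeneous_diff homogeneous_add homogeneous_scale3)
    note minus_2_power_neq_1[OF n]
    then have "eval3 F' (vector [1, 2, 0]) = 0" "eval3 F' (vector [0, 1, 2]) = 0"
      "eval3 F' (vector [2, 0, 1]) = 0"
      by (simp_all add: F'_def K_def side_form_def vector_3)
    then have zero: "eval3 F' (vector [x, y, 0]) = 0" "eval3 F' (vector [0, x, y]) = 0"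
      "eval3 F' (vector [x, 0, y]) = 0" for x y
      using sections_vanish_on_sides[OF m2 F'] by blast+
    have "scale3 (coeff3 F' a b c) (X ^ a * Y ^ b * Z ^ c) \<in> poly3.span W" for a b c
    proof (cases "coeff3 F' a b c = 0")
      case True
      then show ?thesis by (simp only: poly3.scale_zero_left poly3.span_zero)
    next
      case False
      then have "a \<noteq> 0" "b \<noteq> 0" "c \<noteq> 0"
        using coeff3_eq_0_if_vanishes_on_sides[of F'] zero by metis+
      moreover have "a + b + c = m" using F' False by (auto simp: sections_def homogeneous_def)
      ultimately have "X ^ a * Y ^ b * Z ^ c = mon (a, b)" "(a, b) \<in> T"
        by (auto simp: mon_def T_def)
      then show ?thesis by (intro poly3.span_scale poly3.span_base) (simp add: W_def)
    qed
    then have "F' \<in> poly3.span W"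
      by (subst poly3_expand) (intro poly3.span_sum)
    with K have "F' + K \<in> poly3.span W" by (intro poly3.span_add)
    then show ?thesis by (simp add: F'_def)
  qed
  then have "poly3.dim (sections m (full_monomial_dual m)) \<le> card W"
    by (intro poly3.dim_le_card W subsetI)
  with card show ?thesis by simp
qed

lemma dim_sections_fat:
  assumes m: "m > 2" and v: "v \<noteq> 0" and gen: "eval3 (general_poly (m - 2)) v \<noteq> 0"
  shows "poly3.dim (sections_fat m (full_monomial_dual m) (m - 1) (abs_proj_plane v)) = 1"
proof (rule poly3.dim_unique)
  let ?E = "unexpected_form (m - 2) v"
  show "{?E} \<subseteq> sections_fat m (full_monomial_dual m) (m - 1) (abs_proj_plane v)"
    using unexpected_form_sections_fat[OF m v] by simp
  show "sections_fat m (full_monomial_dual m) (m - 1) (abs_proj_plane v) \<subseteq> poly3.span {?E}"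
    using sections_fat_subset_span[OF m gen] by (auto simp: poly3.span_singleton)
  have "?E \<noteq> 0"
    using irreducible_unexpected_form[OF _ gen] m by (auto simp: irreducible_def)
  then show "poly3.independent {?E}" by simp
qed simp

theorem proposition3p4:
  fixes m :: nat
  assumes "m \<ge> 4"
  shows "admits_unexpected_curves (full_monomial_dual m) m
       \<and> (\<forall>j. admits_unexpected_curves (full_monomial_dual m) j \<longrightarrow> m \<le> j)
       \<and> generically (\<lambda>q. \<forall>F \<in> sections_fat m (full_monomial_dual m) (m - 1) q.
            F \<noteq> 0 \<longrightarrow> irreducible F)"
proof (intro conjI allI impI)
  have m: "m > 2" and n: "m - 2 > 0" using assms by simp_all
  \<comment> \<open>The dimension is 1 for general \<open>q\<close>, while the expected one is at
    most 0.\<close>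
  have "generically (\<lambda>q. int (poly3.dim (sections_fat m (full_monomial_dual m) (m - 1) q))
      > max 0 (int (poly3.dim (sections m (full_monomial_dual m))) - int (m choose 2)))"
    using dim_sections_le[OF assms] dim_sections_fat[OF m]
    by (intro generically_if_general[OF n]) simp
  then show "admits_unexpected_curves (full_monomial_dual m) m"
    using m finite_full_monomial_dual[OF m] by (simp add: admits_unexpected_curves_def)
  show "m \<le> j" if "admits_unexpected_curves (full_monomial_dual m) j" for j
  proof (rule ccontr)
    assume "\<not> m \<le> j"
    have j: "j \<ge> 2" and unexp: "generically (\<lambda>q.
        int (poly3.dim (sections_fat j (full_monomial_dual m) (j - 1) q))
          > max 0 (int (poly3.dim (sections j (full_monomial_dual m))) - int (j choose 2)))"
      using that by (simp_all add: admits_unexpected_curves_def)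
    \<comment> \<open>Unexpected curves need positive dimension at a general point; as two generic
      conditions hold at a common point, dimension zero is a contradiction.\<close>
    have "generically (\<lambda>q. poly3.dim (sections_fat j (full_monomial_dual m) (j - 1) q) = 0)"
    proof (rule generically_if_general[OF n])
      fix v assume "eval3 (general_poly (m - 2)) v \<noteq> 0"
      then have "v $ 1 \<noteq> 0" "v $ 3 \<noteq> 0" using general_polyD[OF _ n] by blast+
      then have "sections_fat j (full_monomial_dual m) (j - 1) (abs_proj_plane v) \<subseteq> {0}"
        using sections_fat_low_degree[OF m j] \<open>\<not> m \<le> j\<close> by auto
      then show "poly3.dim (sections_fat j (full_monomial_dual m) (j - 1) (abs_proj_plane v)) = 0"
        using poly3.dim_le_card[of _ "{}"] by simp
    qed
    from generically_imp_ex[OF generically_conj[OF unexp this]] show False by auto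
  qed
  show "generically (\<lambda>q. \<forall>F \<in> sections_fat m (full_monomial_dual m) (m - 1) q.
      F \<noteq> 0 \<longrightarrow> irreducible F)"
  proof (rule generically_if_general[OF n], intro ballI impI)
    fix v F
    assume gen: "eval3 (general_poly (m - 2)) v \<noteq> 0" and "F \<noteq> 0"
      and F: "F \<in> sections_fat m (full_monomial_dual m) (m - 1) (abs_proj_plane v)"
    obtain \<kappa> where \<kappa>: "F = scale3 \<kappa> (unexpected_form (m - 2) v)"
      using sections_fat_subset_span[OF m gen F] by blast
    with \<open>F \<noteq> 0\<close> have "\<kappa> \<noteq> 0" by (auto simp: scale3_def)
    \<comment> \<open>The nonzero constant is a unit, so irreducibility passes from the unexpected
      form to \<open>F\<close>.\<close>
    then have "[:[:[:\<kappa>:]:]:] * [:[:[:1 / \<kappa>:]:]:] = (1 :: poly3)" by (intro eval3_eqI) simp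
    then have "is_unit ([:[:[:\<kappa>:]:]:] :: poly3)" by (metis dvd_triv_left)
    then show "irreducible F"
      using irreducible_unexpected_form[OF n gen]
      unfolding \<kappa> scale3_eq_mult by (simp only: irreducible_mult_unit_left)
  qed
qed

end
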